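(* Consider $$-\left(\varphi_p(u')\right)'+q(x)\varphi_p(u)=\lambda m(x)f(u),\quad 0<x<T,\qquad u(0)=u(T),\ u'(0)=u'(T),\qquad (N)$$ where $f\in C(\mathbb{R},\mathbb{R})$ satisfies $f(s)s>0$ for $s\neq0$. If $f_0=0$ and $f_\infty\in(0,+\infty)$, then for any $\lambda\in(\lambda_0^+/f_\infty,+\infty)\cup(-\infty,\lambda_0^-/f_\infty)$, problem (N) has two solutions $u^+$ and $u^-$ such that $u^+$ is positive and $u^-$ is negative on $[0,T]$.
   Context: Here $T>0$, $1<p<+\infty$, $\varphi_p(s)=|s|^{p-2}s$ (with $\varphi_p(0)=0$), $q\in C([0,T];[0,+\infty))$ with $q\not\equiv0$, and $m:[0,T]\to\mathbb{R}$ is a continuous sign-changing weight (it takes both positive and negative values). $f_0=\lim_{|s|\to0}f(s)/\varphi_p(s)$ and $f_\infty=\lim_{|s|\to+\infty}f(s)/\varphi_p(s)$ (assumed to exist). With $W_T^{1,p}(0,T)=\{u\in W^{1,p}(0,T)\mid u(0)=u(T)\}$, $\lambda_0^+=\inf\{\int_0^T(|u'|^p+q|u|^p)\,dx\mid u\in W_T^{1,p}(0,T),\ \int_0^T m|u|^p\,dx=1\}>0$ and $\lambda_0^-=\max\{-\int_0^T(|u'|^p+q|u|^p)\,dx\mid u\in W_T^{1,p}(0,T),\ \int_0^T -m|u|^p\,dx=1\}<0$. Solutions are classical. *)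

theory Defs
  imports "HOL-Analysis.Analysis"
begin

text \<open>Since \<open>0 powr a = 0\<close>, this gives the value 0 at 0 for every \<open>p\<close>.\<close>

definition phi :: "real \<Rightarrow> real \<Rightarrow> real" where
  "phi p s = \<bar>s\<bar> powr (p - 2) * s"

definition Lp_on :: "real \<Rightarrow> real set \<Rightarrow> (real \<Rightarrow> real) \<Rightarrow> bool" where
  "Lp_on p A g \<longleftrightarrow> set_borel_measurable lebesgue A g \<and>
     set_integrable lebesgue A (\<lambda>x. \<bar>g x\<bar> powr p)"

definition C1c :: "real set \<Rightarrow> (real \<Rightarrow> real) set" where
  "C1c A = {h. h C1_differentiable_on UNIV \<and>
     (\<exists>K. compact K \<and> K \<subseteq> A \<and> (\<forall>x. x \<notin> K \<longrightarrow> h x = 0))}"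

definition weak_deriv_on :: "real set \<Rightarrow> (real \<Rightarrow> real) \<Rightarrow> (real \<Rightarrow> real) \<Rightarrow> bool" where
  "weak_deriv_on A u g \<longleftrightarrow>
     (\<forall>h\<in>C1c A. (LINT x:A|lebesgue. u x * deriv h x) = - (LINT x:A|lebesgue. g x * h x))"

text \<open>The space \<open>{u \<in> W\<^sup>1\<^sup>,\<^sup>p(0,T). u(0) = u(T)}\<close>, as the set of pairs of a function and a
  weak derivative of it. An element of \<open>W\<^sup>1\<^sup>,\<^sup>p(0,T)\<close> is represented by its continuous
  representative on \<open>[0,T]\<close>, for which the boundary values make sense; the weak derivative
  is determined almost everywhere.\<close>

definition W1p_per :: "real \<Rightarrow> real \<Rightarrow> ((real \<Rightarrow> real) \<times> (real \<Rightarrow> real)) set" where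
  "W1p_per T p = {(u, u'). continuous_on {0..T} u \<and> Lp_on p {0<..<T} u \<and> Lp_on p {0<..<T} u' \<and>
     weak_deriv_on {0<..<T} u u' \<and> u 0 = u T}"

definition lambda0_plus ::
  "real \<Rightarrow> real \<Rightarrow> (real \<Rightarrow> real) \<Rightarrow> (real \<Rightarrow> real) \<Rightarrow> real" where
  "lambda0_plus T p q m =
     Inf {(LINT x:{0<..<T}|lebesgue. \<bar>u' x\<bar> powr p + q x * \<bar>u x\<bar> powr p) | u u'.
       (u, u') \<in> W1p_per T p \<and> (LINT x:{0<..<T}|lebesgue. m x * \<bar>u x\<bar> powr p) = 1}"

text \<open>The supremum below is attained, hence a maximum.\<close>

definition lambda0_minus ::
  "real \<Rightarrow> real \<Rightarrow> (real \<Rightarrow> real) \<Rightarrow> (real \<Rightarrow> real) \<Rightarrow> real" where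
  "lambda0_minus T p q m =
     Sup {- (LINT x:{0<..<T}|lebesgue. \<bar>u' x\<bar> powr p + q x * \<bar>u x\<bar> powr p) | u u'.
       (u, u') \<in> W1p_per T p \<and> (LINT x:{0<..<T}|lebesgue. - m x * \<bar>u x\<bar> powr p) = 1}"

text \<open>Classical solutions of the periodic problem: \<open>u \<in> C\<^sup>1[0,T]\<close> (one-sided derivatives at the
  endpoints), \<open>\<phi>\<^sub>p(u')\<close> is differentiable in \<open>(0,T)\<close> and the equation holds pointwise there.
  Continuity of the derivative \<open>w\<close> of \<open>\<phi>\<^sub>p(u')\<close> follows from the equation when
  \<open>q\<close>, \<open>m\<close> and \<open>f\<close> are continuous.\<close>

definition periodic_solution ::
  "real \<Rightarrow> real \<Rightarrow> (real \<Rightarrow> real) \<Rightarrow> (real \<Rightarrow> real) \<Rightarrow> (real \<Rightarrow> real) \<Rightarrow> real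
     \<Rightarrow> (real \<Rightarrow> real) \<Rightarrow> bool" where
  "periodic_solution T p q m f l u \<longleftrightarrow>
     (\<exists>u' w.
        (\<forall>x\<in>{0..T}. (u has_real_derivative u' x) (at x within {0..T})) \<and>
        continuous_on {0..T} u' \<and>
        (\<forall>x\<in>{0<..<T}. ((\<lambda>y. phi p (u' y)) has_real_derivative w x) (at x)) \<and>
        (\<forall>x\<in>{0<..<T}. - w x + q x * phi p (u x) = l * m x * f (u x)) \<and>
        u 0 = u T \<and> u' 0 = u' T)"

end

theory Submission
  imports Defs "HOL-Complex_Analysis.Great_Picard"
begin

text \<open>
  A solution of constant sign is written as \<open>u = \<plusminus>e\<^sup>v\<close>. With \<open>w = \<phi>\<^sub>p(u')/\<phi>\<^sub>p(u)\<close>, \<open>p' = p/(p-1)\<close> and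
  \<open>k(v) = f(u)/\<phi>\<^sub>p(u)\<close>, a bounded continuous function with limits \<open>f\<^sub>0 = 0\<close> and \<open>f\<^sub>\<infinity>\<close> at \<open>\<minusplus>\<infinity>\<close>,
  the problem becomes the periodic Riccati system
  \<open>v' = \<phi>\<^sub>p\<^sub>'(w)\<close>, \<open>w' = q - \<lambda> m k(v) - c - (p - 1) |w|\<^sup>p\<^sup>'\<close> with \<open>c = 0\<close>. For every \<open>R > 0\<close>, Brouwer's theorem for
  the three unknowns \<open>v(0)\<close>, \<open>w(0)\<close>, \<open>c\<close> (applied to Euler polygons, then passing to the limit) yields
  a periodic solution with \<open>c = 0\<close>, or \<open>v(0) = R\<close> and \<open>c > 0\<close>, or \<open>v(0) = -R\<close> and \<open>c < 0\<close>, where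
  \<open>v - v(0)\<close> is bounded independently of \<open>R\<close>. For large \<open>R\<close> the last case contradicts
  \<open>\<integral> (w e\<^sup>p\<^sup>v)' = 0\<close>, as \<open>k(v)\<close> is nearly 0 and \<open>q\<close> is nonnegative and nonzero. In the second case
  \<open>k(v)\<close> is nearly \<open>f\<^sub>\<infinity>\<close>, and Picone's inequality bounds \<open>\<integral> (|U'|\<^sup>p + (q - \<lambda> f\<^sub>\<infinity> m) |U|\<^sup>p)\<close> from below by
  nearly 0 for each \<open>U\<close>; but the condition on \<open>\<lambda>\<close> provides a \<open>U\<close> for which this integral is negative.
\<close>

section \<open>A boundary value problem for bounded continuous vector fields\<close>

primrec euler :: "(real \<Rightarrow> 'a \<Rightarrow> 'a) \<Rightarrow> real \<Rightarrow> 'a \<Rightarrow> nat \<Rightarrow> 'a::real_normed_vector" where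
  "euler F h x 0 = x"
| "euler F h x (Suc k) = euler F h x k + h *\<^sub>R F (real k * h) (euler F h x k)"

text \<open>\<open>ramp h (t - i * h)\<close> is the part of the \<open>i\<close>-th time step that
  has elapsed at time \<open>t\<close>.\<close>

definition ramp :: "real \<Rightarrow> real \<Rightarrow> real" where
  "ramp h s = max 0 (min h s)"

text \<open>Writing the polygon as one sum of ramps gives values and increments by a single formula,
  with no case distinction on the step that contains \<open>t\<close>.\<close>

definition euler_polygon :: "(real \<Rightarrow> 'a \<Rightarrow> 'a) \<Rightarrow> real \<Rightarrow> nat \<Rightarrow> 'a \<Rightarrow> real \<Rightarrow> 'a::real_normed_vector" where
  "euler_polygon F h N x t =
     x + (\<Sum>i<N. ramp h (t - real i * h) *\<^sub>R F (real i * h) (euler F h x i))"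

lemma sum_ramp:
  assumes "0 \<le> h" "0 \<le> t"
  shows "(\<Sum>i<N. ramp h (t - real i * h)) = min t (real N * h)"
proof (induction N)
  case 0
  then show ?case using assms by simp
next
  case (Suc N)
  have "0 \<le> real N * h" using assms by simp
  with Suc assms show ?case
    by (auto simp: ramp_def algebra_simps min_def max_def)
qed

lemma euler_polygon_node:
  assumes "0 \<le> h" "j \<le> N"
  shows "euler_polygon F h N x (real j * h) = euler F h x j"
proof -
  have ramp: "ramp h (real j * h - real i * h) = (if i < j then h else 0)" for i
  proof (cases "i < j")
    case True
    then have "1 \<le> real j - real i" by linarith
    from mult_right_mono[OF this \<open>0 \<le> h\<close>] have "h \<le> (real j - real i) * h" by simp
    with True \<open>0 \<le> h\<close> show ?thesis by (simp add: ramp_def left_diff_distrib)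
  next
    case False
    then have "(real j - real i) * h \<le> 0"
      using \<open>0 \<le> h\<close> by (simp add: mult_nonpos_nonneg)
    with False \<open>0 \<le> h\<close> show ?thesis by (simp add: ramp_def left_diff_distrib)
  qed
  have e: "euler F h x j = x + (\<Sum>i<j. h *\<^sub>R F (real i * h) (euler F h x i))" for j
    by (induction j) (auto simp: algebra_simps)
  have "(\<Sum>i<N. (if i < j then h else 0) *\<^sub>R F (real i * h) (euler F h x i))
      = (\<Sum>i<j. h *\<^sub>R F (real i * h) (euler F h x i))"
    using assms by (intro sum.mono_neutral_cong_right) auto
  with e[of j] show ?thesis by (simp add: euler_polygon_def ramp)
qed

text \<open>Increments of the polygon are averages of the slopes with total weight \<open>t - s\<close>; \<open>y = 0\<close> gives
  the Lipschitz bound, \<open>y\<close> close to all slopes the differential equation in the limit.\<close>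

lemma euler_polygon_increment:
  assumes h: "0 \<le> h" and st: "0 \<le> s" "s \<le> t" "t \<le> real N * h"
    and F: "\<And>i. i < N \<Longrightarrow> s - h < real i * h \<Longrightarrow> real i * h < t \<Longrightarrow>
      norm (F (real i * h) (euler F h x i) - y) \<le> e"
  shows "norm (euler_polygon F h N x t - euler_polygon F h N x s - (t - s) *\<^sub>R y) \<le> e * (t - s)"
proof -
  define d where "d i = ramp h (t - real i * h) - ramp h (s - real i * h)" for i
  have d0: "0 \<le> d i" for i
    using st by (auto simp: d_def ramp_def)
  have dsum: "(\<Sum>i<N. d i) = t - s"
    using st by (simp add: d_def sum_subtractf sum_ramp h)
  have dz: "d i = 0" if "\<not> (s - h < real i * h \<and> real i * h < t)" for i
    using that st h by (auto simp: d_def ramp_def min_def max_def)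
  have "euler_polygon F h N x t - euler_polygon F h N x s - (t - s) *\<^sub>R y
      = (\<Sum>i<N. d i *\<^sub>R (F (real i * h) (euler F h x i) - y))"
    unfolding dsum[symmetric] euler_polygon_def d_def
    by (simp add: sum_subtractf scaleR_sum_left algebra_simps sum.distrib)
  also have "norm \<dots> \<le> (\<Sum>i<N. d i * e)"
  proof (rule sum_norm_le)
    fix i assume "i \<in> {..<N}"
    then show "norm (d i *\<^sub>R (F (real i * h) (euler F h x i) - y)) \<le> d i * e"
      using dz[of i] F[of i] d0[of i] by (cases "s - h < real i * h \<and> real i * h < t") (auto intro: mult_left_mono)
  qed
  also have "\<dots> = e * (t - s)"
    by (simp add: sum_distrib_right[symmetric] dsum)
  finally show ?thesis .
qed

text \<open>A merely continuous field need not have unique solutions, so its flow may fail to exist;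
  the discrete scheme still depends continuously on the initial value, which is what Brouwer's
  theorem asks for.\<close>

lemma continuous_on_euler:
  assumes cont: "continuous_on ({0..T} \<times> UNIV) (\<lambda>(t, x). F t x)"
    and "0 \<le> h" "real N * h \<le> T" "k \<le> N"
  shows "continuous_on K (\<lambda>x. euler F h x k)"
  using \<open>k \<le> N\<close>
proof (induction k)
  case 0
  show ?case by simp
next
  case (Suc k)
  have "real k * h \<le> real N * h" using Suc.prems \<open>0 \<le> h\<close> by (intro mult_right_mono) auto
  then have "real k * h \<in> {0..T}" using assms by auto
  then have "continuous_on K (\<lambda>x. F (real k * h) (euler F h x k))"
    using Suc
    by (intro continuous_on_compose2[OF cont, of K "\<lambda>x. (real k * h, euler F h x k)", simplified])
       (auto intro!: continuous_intros)
  then show ?case using Suc by (auto intro!: continuous_intros)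
qed

text \<open>The boundary condition is a fixed point equation for the initial value. Brouwer's
  theorem solves it for each Euler scheme, the Arzela-Ascoli theorem extracts a uniformly convergent
  subsequence of the polygons, and continuity of \<open>R\<close> carries the fixed point equation
  to the limit.\<close>

theorem boundary_value_problem:
  fixes F :: "real \<Rightarrow> 'a::euclidean_space \<Rightarrow> 'a"
  assumes T: "0 < T"
    and cont: "continuous_on ({0..T} \<times> UNIV) (\<lambda>(t, x). F t x)"
    and bound: "\<And>t x. t \<in> {0..T} \<Longrightarrow> norm (F t x) \<le> B"
    and K: "compact K" "convex K" "K \<noteq> {}"
    and contR: "continuous_on (K \<times> UNIV) (\<lambda>(x, y). R x y)"
    and R: "\<And>x y. x \<in> K \<Longrightarrow> R x y \<in> K"
  obtains x where "\<And>t. t \<in> {0..T} \<Longrightarrow> (x has_vector_derivative F t (x t)) (at t within {0..T})"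
    and "x 0 \<in> K" and "R (x 0) (x T) = x 0"
proof -
  have B0: "0 \<le> B" using order_trans[OF norm_ge_zero bound[of 0 undefined]] T by simp
  \<comment> \<open>With \<open>Suc n\<close> steps the last node is exactly \<open>T\<close>, so
    the endpoint of the polygon is the Euler iterate used in the fixed point equation.\<close>
  define h where "h n = T / real (Suc n)" for n
  have h: "0 < h n" "real (Suc n) * h n = T" for n
    using T by (auto simp: h_def)
  have "\<exists>x\<in>K. R x (euler F (h n) x (Suc n)) = x" for n
  proof -
    have contE: "continuous_on K (\<lambda>x. euler F (h n) x (Suc n))"
      using h[of n] by (intro continuous_on_euler[OF cont, of _ "Suc n"]) auto
    have "continuous_on K (\<lambda>x. R x (euler F (h n) x (Suc n)))"
      using continuous_on_compose2[OF contR, of K "\<lambda>x. (x, euler F (h n) x (Suc n))"]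
        continuous_on_Pair[OF continuous_on_id' contE]
      by (auto simp del: euler.simps)
    moreover have "(\<lambda>x. R x (euler F (h n) x (Suc n))) \<in> K \<rightarrow> K"
      using R by blast
    ultimately obtain x where "x \<in> K" "R x (euler F (h n) x (Suc n)) = x"
      by (rule brouwer[OF K])
    then show ?thesis by (rule bexI[rotated])
  qed
  then obtain x0 where x0: "\<And>n. x0 n \<in> K" "\<And>n. R (x0 n) (euler F (h n) (x0 n) (Suc n)) = x0 n"
    by metis
  define X where "X n = euler_polygon F (h n) (Suc n) (x0 n)" for n
  have node: "X n (real j * h n) = euler F (h n) (x0 n) j" if "j \<le> Suc n" for n j
    unfolding X_def using h[of n] that by (intro euler_polygon_node) auto
  have X0: "X n 0 = x0 n" and XT: "X n T = euler F (h n) (x0 n) (Suc n)" for n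
    using node[of 0 n] node[of "Suc n" n] h(2)[of n] by (simp_all del: euler.simps(2))
  have inT: "real i * h n \<in> {0..T}" if "i \<le> Suc n" for i n
  proof -
    have "real i * h n \<le> real (Suc n) * h n"
      using that h(1)[of n] by (intro mult_right_mono) auto
    with h[of n] show ?thesis by simp
  qed
  \<comment> \<open>Symmetric in \<open>s\<close> and \<open>t\<close>, since the limit has to be
    differentiated from both sides.\<close>
  have incr: "norm (X n t - X n s - (t - s) *\<^sub>R y) \<le> e * \<bar>t - s\<bar>"
    if "t \<in> {0..T}" "s \<in> {0..T}"
      "\<And>i. i \<le> n \<Longrightarrow> min s t - h n < real i * h n \<Longrightarrow> real i * h n < max s t \<Longrightarrow>
        norm (F (real i * h n) (X n (real i * h n)) - y) \<le> e" for n s t y e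
  proof (cases "s \<le> t")
    case True
    then show ?thesis
      using euler_polygon_increment[of "h n" s t "Suc n" F "x0 n" y e] that h[of n]
      by (simp add: X_def[symmetric] node less_Suc_eq_le)
  next
    case False
    then have "norm (X n s - X n t - (s - t) *\<^sub>R y) \<le> e * (s - t)"
      using euler_polygon_increment[of "h n" t s "Suc n" F "x0 n" y e] that h[of n]
      by (simp add: X_def[symmetric] node less_Suc_eq_le)
    moreover have "norm (X n t - X n s - (t - s) *\<^sub>R y) = norm (X n s - X n t - (s - t) *\<^sub>R y)"
      by (subst norm_minus_cancel[symmetric]) (simp add: algebra_simps)
    moreover have "\<bar>t - s\<bar> = s - t" using False by simp
    ultimately show ?thesis by (simp only:)
  qed
  have lip: "norm (X n t - X n s) \<le> B * \<bar>t - s\<bar>" if "t \<in> {0..T}" "s \<in> {0..T}" for n s t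
    using incr[of t s n 0 B] that bound inT by simp
  obtain C where C: "\<And>x. x \<in> K \<Longrightarrow> norm x \<le> C"
    using compact_imp_bounded[OF K(1)] unfolding bounded_iff by blast
  have bnd: "norm (X n t) \<le> C + B * T" if "t \<in> {0..T}" for n t
  proof -
    have "norm (X n t) \<le> norm (X n 0) + norm (X n t - X n 0)"
      using norm_triangle_sub by blast
    also have "\<dots> \<le> C + B * \<bar>t - 0\<bar>"
      using C[OF x0(1)[of n]] lip[of t 0 n] that T X0[of n] by (intro add_mono) auto
    also have "\<dots> \<le> C + B * T" using that B0 by (auto intro!: mult_left_mono)
    finally show ?thesis .
  qed
  have equi: "\<exists>d>0. \<forall>n y. y \<in> {0..T} \<and> norm (t - y) < d \<longrightarrow> norm (X n t - X n y) < e"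
    if "t \<in> {0..T}" "0 < e" for t e
  proof (intro exI[of _ "e / (B + 1)"] conjI allI impI)
    show "0 < e / (B + 1)" using B0 that by simp
    fix n y assume y: "y \<in> {0..T} \<and> norm (t - y) < e / (B + 1)"
    have "norm (X n t - X n y) \<le> B * \<bar>t - y\<bar>" using lip that y by blast
    also have "\<dots> \<le> (B + 1) * \<bar>t - y\<bar>" by (intro mult_right_mono) auto
    also have "\<dots> < e" using y B0 by (simp add: pos_less_divide_eq mult.commute)
    finally show "norm (X n t - X n y) < e" .
  qed
  obtain x k where "continuous_on {0..T} x" and k: "strict_mono (k :: nat \<Rightarrow> nat)"
    and lim: "\<And>e. 0 < e \<Longrightarrow> \<exists>N. \<forall>n t. n \<ge> N \<and> t \<in> {0..T} \<longrightarrow> norm (X (k n) t - x t) < e"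
    by (rule Arzela_Ascoli[OF compact_Icc bnd equi]) (assumption+, rule that)
  have ptw: "(\<lambda>n. X (k n) t) \<longlonglongrightarrow> x t" if "t \<in> {0..T}" for t
    unfolding LIMSEQ_def dist_norm using lim that by blast
  have h0: "(\<lambda>n. h (k n)) \<longlonglongrightarrow> 0"
  proof -
    have "h \<longlonglongrightarrow> 0"
      unfolding h_def using LIMSEQ_Suc[OF lim_const_over_n[of T]] by simp
    from LIMSEQ_subseq_LIMSEQ[OF this k] show ?thesis by (simp add: o_def)
  qed
  have "(x has_vector_derivative F t (x t)) (at t within {0..T})" if t: "t \<in> {0..T}" for t
    unfolding has_vector_derivative_def has_derivative_within_alt
  proof (intro conjI allI impI)
    show "bounded_linear (\<lambda>s. s *\<^sub>R F t (x t))" by (rule bounded_linear_scaleR_left)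
    fix e :: real assume e: "0 < e"
    obtain d where d: "0 < d" and
      dF: "\<And>s y. s \<in> {0..T} \<Longrightarrow> dist (s, y) (t, x t) < d \<Longrightarrow> norm (F s y - F t (x t)) < e"
      using cont t e unfolding continuous_on_iff by (fastforce simp: dist_norm)
    \<comment> \<open>The nodes that matter lie within \<open>2 * r\<close> of \<open>t\<close>;
      there the polygon moves by at most \<open>2 * B * r\<close>. Together these are
      \<open>d / 2\<close>, which leaves room for the error \<open>d / 8\<close> of the polygon at
      \<open>t\<close>.\<close>
    define r where "r = d / (4 * (B + 1))"
    have r: "0 < r" "(B + 1) * r = d / 4" using d B0 by (auto simp: r_def field_simps)
    have rB: "B * r + r = d / 4" "0 \<le> B * r" using r(2) B0 r(1) by (auto simp: algebra_simps)
    show "\<exists>d>0. \<forall>s\<in>{0..T}. norm (s - t) < d \<longrightarrow>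
        norm (x s - x t - (s - t) *\<^sub>R F t (x t)) \<le> e * norm (s - t)"
    proof (intro exI[of _ r] conjI ballI impI)
      fix s assume s: "s \<in> {0..T}" "norm (s - t) < r"
      obtain N where N: "\<And>n. n \<ge> N \<Longrightarrow> norm (X (k n) t - x t) < d / 8"
        using lim[of "d / 8"] d t by (metis zero_less_divide_iff zero_less_numeral)
      have "\<forall>\<^sub>F n in sequentially. norm (X (k n) s - X (k n) t - (s - t) *\<^sub>R F t (x t)) \<le> e * \<bar>s - t\<bar>"
        using order_tendstoD(2)[OF h0 r(1)] eventually_ge_at_top[of N]
      proof eventually_elim
        case (elim n)
        show ?case
        proof (rule incr[OF s(1) t])
          fix i assume i: "i \<le> k n" "min t s - h (k n) < real i * h (k n)" "real i * h (k n) < max t s"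
          let ?u = "real i * h (k n)"
          have u: "?u \<in> {0..T}" using inT i(1) by simp
          have ut: "\<bar>?u - t\<bar> < 2 * r" using i(2,3) s(2) elim(1) r(1) by (auto simp: min_def max_def abs_if split: if_splits)
          have "norm (X (k n) ?u - X (k n) t) \<le> B * \<bar>?u - t\<bar>" using lip u t by blast
          also have "\<dots> \<le> B * (2 * r)" using ut B0 by (intro mult_left_mono) auto
          finally have "norm (X (k n) ?u - x t) \<le> 2 * (B * r) + d / 8"
            using N[OF elim(2)] norm_triangle_sub[of "X (k n) ?u - x t" "X (k n) t - x t"] by simp
          moreover have "dist (?u, X (k n) ?u) (t, x t) \<le> \<bar>?u - t\<bar> + norm (X (k n) ?u - x t)"
            using norm_Pair_le[of "?u - t" "X (k n) ?u - x t"] by (simp add: dist_norm)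
          ultimately have "dist (?u, X (k n) ?u) (t, x t) < d"
            using ut rB d by linarith
          with dF[OF u] show "norm (F ?u (X (k n) ?u) - F t (x t)) \<le> e" by (simp add: less_imp_le)
        qed
      qed
      moreover have "(\<lambda>n. norm (X (k n) s - X (k n) t - (s - t) *\<^sub>R F t (x t)))
          \<longlonglongrightarrow> norm (x s - x t - (s - t) *\<^sub>R F t (x t))"
        using s t by (intro tendsto_intros ptw) auto
      ultimately show "norm (x s - x t - (s - t) *\<^sub>R F t (x t)) \<le> e * norm (s - t)"
        by (intro tendsto_upperbound[of _ _ sequentially]) auto
    qed (use r in auto)
  qed
  moreover have x0K: "x 0 \<in> K"
    using closed_sequentially[OF compact_imp_closed[OF K(1)], of "\<lambda>n. X (k n) 0" "x 0"] ptw[of 0] T X0 x0(1)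
    by simp
  moreover have "R (x 0) (x T) = x 0"
  proof -
    have "(\<lambda>n. (case (X (k n) 0, X (k n) T) of (x, y) \<Rightarrow> R x y)) \<longlonglongrightarrow> (case (x 0, x T) of (x, y) \<Rightarrow> R x y)"
      using T x0K x0(1) X0
      by (intro continuous_on_tendsto_compose[OF contR] tendsto_intros ptw) auto
    then have "(\<lambda>n. X (k n) 0) \<longlonglongrightarrow> R (x 0) (x T)"
      using x0(2) X0 XT by (simp del: euler.simps)
    moreover have "(\<lambda>n. X (k n) 0) \<longlonglongrightarrow> x 0" using T by (intro ptw) simp
    ultimately show ?thesis by (rule LIMSEQ_unique)
  qed
  ultimately show thesis by (rule that)
qed

section \<open>The nonlinearity \<open>\<phi>\<^sub>p\<close>\<close>

lemma times_phi: "s * phi p s = \<bar>s\<bar> powr p"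
proof (cases "s = 0")
  case False
  then have "s * phi p s = \<bar>s\<bar> powr (p - 2) * \<bar>s\<bar> powr 2"
    by (simp add: phi_def power2_eq_square)
  also have "\<dots> = \<bar>s\<bar> powr p"
    by (subst powr_add[symmetric]) simp
  finally show ?thesis .
qed simp

lemma phi_minus: "phi p (- s) = - phi p s"
  by (simp add: phi_def)

lemma phi_mult: "phi p (a * b) = phi p a * phi p b"
  by (simp add: phi_def abs_mult powr_mult)

lemma phi_pos: "0 < s \<Longrightarrow> phi p s = s powr (p - 1)"
  using powr_add[of s "p - 2" 1] by (simp add: phi_def)

lemma phi_exp: "phi p (exp v) = exp ((p - 1) * v)"
  by (simp add: phi_pos powr_def)

lemma phi_0 [simp]: "phi p 0 = 0"
  by (simp add: phi_def)

text \<open>The exponents \<open>p - 1\<close> and \<open>p / (p - 1) - 1\<close> are reciprocal.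
  This recovers \<open>phi p u'\<close> from the Riccati variable.\<close>

lemma phi_conjugate:
  assumes "1 < p"
  shows "phi p (phi (p / (p - 1)) s) = s"
proof -
  have pos: "phi p (phi (p / (p - 1)) s) = s" if "0 < s" for s
  proof -
    have "(p / (p - 1) - 1) * (p - 1) = 1" using assms by (simp add: field_simps)
    then have "(s powr (p / (p - 1) - 1)) powr (p - 1) = s" using that by (simp add: powr_powr)
    then show ?thesis using that by (simp add: phi_pos)
  qed
  consider "0 < s" | "s = 0" | "0 < - s" by linarith
  then show ?thesis using pos[of s] pos[of "- s"] by cases (auto simp: phi_minus)
qed

lemma continuous_on_phi:
  assumes "1 < p"
  shows "continuous_on S (phi p)"
proof -
  \<comment> \<open>For \<open>p < 2\<close> the factor \<open>\<bar>s\<bar> powr (p - 2)\<close> is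
    unbounded near 0; the powers of the positive and negative parts have the positive exponent
    \<open>p - 1\<close>.\<close>
  have "phi p = (\<lambda>s. (max 0 s) powr (p - 1) - (max 0 (- s)) powr (p - 1))"
  proof
    fix s :: real
    consider "0 < s" | "s = 0" | "0 < - s" by linarith
    then show "phi p s = (max 0 s) powr (p - 1) - (max 0 (- s)) powr (p - 1)"
      using phi_pos[of s p] phi_pos[of "- s" p] phi_minus[of p s] by cases auto
  qed
  moreover have "continuous_on S (\<lambda>s. (max 0 s) powr (p - 1) - (max 0 (- s)) powr (p - 1))"
    using assms by (intro continuous_on_diff continuous_on_powr' continuous_intros) auto
  ultimately show ?thesis by simp
qed

text \<open>Young's inequality for \<open>a\<close> and \<open>c * b powr (p - 1)\<close>,
  multiplied by \<open>p\<close>. With \<open>a\<close>, \<open>b\<close>, \<open>c\<close> the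
  absolute values of \<open>U'\<close>, \<open>U\<close>, \<open>w\<close> it is the pointwise core
  of Picone's inequality.\<close>

lemma Young_powr:
  fixes a b c p :: real
  assumes "1 < p" "0 \<le> a" "0 \<le> b" "0 \<le> c"
  shows "p * c * b powr (p - 1) * a \<le> a powr p + (p - 1) * (c powr (p / (p - 1)) * b powr p)"
proof -
  let ?q = "p / (p - 1)"
  have "1 < ?q" "1 / p + 1 / ?q = 1" using assms(1) by (auto simp: field_simps)
  from Youngs_inequality[OF assms(1) this, of a "c * b powr (p - 1)"]
  have "a * (c * b powr (p - 1)) \<le> a powr p / p + (c * b powr (p - 1)) powr ?q / ?q"
    using assms by simp
  also have "(c * b powr (p - 1)) powr ?q = c powr ?q * b powr p"
    using assms by (simp add: powr_mult powr_powr)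
  finally have "p * (a * (c * b powr (p - 1))) \<le> p * (a powr p / p + c powr ?q * b powr p / ?q)"
    using assms(1) by (intro mult_left_mono) auto
  also have "\<dots> = a powr p + (p - 1) * (c powr ?q * b powr p)"
    using assms(1) by (simp add: field_simps)
  finally show ?thesis by (simp add: mult_ac)
qed

text \<open>The case \<open>c = 1\<close> of \<open>Young_powr\<close> is the tangent inequality of
  a convex function, and it replaces the mean value theorem. The bound is attached to one endpoint,
  so that \<open>Young_powr\<close> can be applied to it again.\<close>

lemma abs_powr_diff_le:
  fixes a b p :: real
  assumes "1 < p"
  shows "\<bar>\<bar>b\<bar> powr p - \<bar>a\<bar> powr p\<bar> \<le> p * (max \<bar>a\<bar> \<bar>b\<bar>) powr (p - 1) * \<bar>b - a\<bar>"
proof -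
  have *: "\<bar>y\<bar> powr p - \<bar>x\<bar> powr p \<le> p * \<bar>y\<bar> powr (p - 1) * \<bar>y - x\<bar>" for x y :: real
  proof -
    have "\<bar>y\<bar> powr (p - 1) * \<bar>y\<bar> = \<bar>y\<bar> powr p"
      using powr_add[of "\<bar>y\<bar>" "p - 1" 1] by (cases "y = 0") auto
    then have "\<bar>y\<bar> powr p - \<bar>x\<bar> powr p \<le> p * \<bar>y\<bar> powr (p - 1) * (\<bar>y\<bar> - \<bar>x\<bar>)"
      using Young_powr[OF assms, of "\<bar>x\<bar>" "\<bar>y\<bar>" 1] by (simp add: algebra_simps)
    also have "\<dots> \<le> p * \<bar>y\<bar> powr (p - 1) * \<bar>y - x\<bar>"
      using assms by (intro mult_left_mono) auto
    finally show ?thesis .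
  qed
  show ?thesis
  proof (cases "\<bar>a\<bar> \<le> \<bar>b\<bar>")
    case True
    moreover have "\<bar>a\<bar> powr p \<le> \<bar>b\<bar> powr p" using True assms by (intro powr_mono2) auto
    ultimately show ?thesis using *[of b a] by (simp add: max_def)
  next
    case False
    moreover have "\<bar>b\<bar> powr p \<le> \<bar>a\<bar> powr p" using False assms by (intro powr_mono2) auto
    ultimately show ?thesis using *[of a b] by (simp add: max_def abs_minus_commute)
  qed
qed

section \<open>Test functions and increments in \<open>W\<^sup>1\<^sup>,\<^sup>p\<close>\<close>

text \<open>The square of the positive part is continuously differentiable; all explicit test
  functions are built from it.\<close>

lemma DERIV_max_0_square: "((\<lambda>x::real. (max 0 x)\<^sup>2) has_real_derivative 2 * max 0 x) (at x)"
proof -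
  consider "x < 0" | "x = 0" | "0 < x" by linarith
  then show ?thesis
  proof cases
    case 1
    have "((\<lambda>x::real. 0) has_real_derivative 2 * max 0 x) (at x)" using 1 by simp
    then show ?thesis
      by (rule has_field_derivative_transform_within_open[where S = "{..<0}"]) (use 1 in auto)
  next
    case 2
    have "\<bar>(max 0 h)\<^sup>2 / h\<bar> \<le> \<bar>h\<bar>" for h :: real
      by (auto simp: max_def power2_eq_square)
    then have "((\<lambda>h::real. (max 0 h)\<^sup>2 / h) \<longlongrightarrow> 0) (at 0)"
      by (intro Lim_null_comparison[OF always_eventually tendsto_rabs_zero[OF tendsto_ident_at]]) simp
    then show ?thesis using 2 by (simp add: DERIV_def)
  next
    case 3
    have "((\<lambda>x::real. x\<^sup>2) has_real_derivative 2 * max 0 x) (at x)"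
      using 3 by (auto intro!: derivative_eq_intros)
    then show ?thesis
      by (rule has_field_derivative_transform_within_open[where S = "{0<..}"]) (use 3 in auto)
  qed
qed

lemma DERIV_max_0_square_chain:
  assumes "(g has_real_derivative g') (at x within S)"
  shows "((\<lambda>x. (max 0 (g x))\<^sup>2) has_real_derivative 2 * max 0 (g x) * g') (at x within S)"
  using DERIV_chain'[OF assms DERIV_max_0_square] by (simp add: mult_ac)

text \<open>A \<open>C\<^sup>1\<close> transition from 0 to 1 across \<open>[0,e]\<close>, and its derivative, a tent of mass 1.\<close>

definition smooth_step :: "real \<Rightarrow> real \<Rightarrow> real" where
  "smooth_step e x = 2 / e\<^sup>2 * ((max 0 x)\<^sup>2 - 2 * (max 0 (x - e / 2))\<^sup>2 + (max 0 (x - e))\<^sup>2)"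

definition tent :: "real \<Rightarrow> real \<Rightarrow> real" where
  "tent e x = 4 / e\<^sup>2 * (max 0 x - 2 * max 0 (x - e / 2) + max 0 (x - e))"

lemma DERIV_smooth_step: "(smooth_step e has_real_derivative tent e x) (at x within S)"
proof -
  have d: "((\<lambda>x. (max 0 (x - c))\<^sup>2) has_real_derivative 2 * max 0 (x - c)) (at x within S)" for c
    using DERIV_max_0_square_chain[OF DERIV_diff[OF DERIV_ident DERIV_const], of c x S] by simp
  from DERIV_cmult[OF DERIV_add[OF DERIV_diff[OF d[of 0] DERIV_cmult[OF d, of 2]] d], of "2 / e\<^sup>2" "e / 2" e]
  have "(smooth_step e has_real_derivative
      2 / e\<^sup>2 * (2 * max 0 x - 2 * (2 * max 0 (x - e / 2)) + 2 * max 0 (x - e))) (at x within S)"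
    unfolding smooth_step_def[abs_def] diff_0_right .
  then show ?thesis by (rule DERIV_cong) (simp add: tent_def algebra_simps add_divide_distrib)
qed

lemma tent_nonneg: "0 < e \<Longrightarrow> 0 \<le> tent e x"
  unfolding tent_def by (intro mult_nonneg_nonneg) (auto simp: max_def field_simps)

lemma tent_eq_0: "0 < e \<Longrightarrow> x \<notin> {0..e} \<Longrightarrow> tent e x = 0"
  by (auto simp: tent_def max_def)

lemma continuous_on_tent: "continuous_on S (tent e)"
  unfolding tent_def[abs_def] by (intro continuous_intros)

lemma smooth_step_0: "0 < e \<Longrightarrow> x \<le> 0 \<Longrightarrow> smooth_step e x = 0"
  by (auto simp: smooth_step_def)

lemma smooth_step_1: "0 < e \<Longrightarrow> e \<le> x \<Longrightarrow> smooth_step e x = 1"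
  by (simp add: smooth_step_def max_def power2_eq_square field_simps)

lemma smooth_step_mono: "0 < e \<Longrightarrow> x \<le> y \<Longrightarrow> smooth_step e x \<le> smooth_step e y"
  by (rule DERIV_nonneg_imp_nondecreasing) (auto intro: DERIV_smooth_step tent_nonneg)

lemma smooth_step_bounds: "0 < e \<Longrightarrow> 0 \<le> smooth_step e x \<and> smooth_step e x \<le> 1"
  using smooth_step_mono[of e "min x 0" x] smooth_step_mono[of e x "max x e"]
  by (simp add: smooth_step_0 smooth_step_1)

text \<open>The tent is a nonnegative kernel of mass 1 supported in \<open>{a..a + e}\<close>, so
  the integral is an average of \<open>U\<close> over that interval.\<close>

lemma integral_times_tent:
  assumes U: "continuous_on {0..T} U" and e: "0 < e" "0 \<le> a" "a + e \<le> T"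
    and near: "\<And>x. x \<in> {a..a + e} \<Longrightarrow> \<bar>U x - c\<bar> \<le> \<eta>"
  shows "\<bar>integral {0..T} (\<lambda>x. U x * tent e (x - a)) - c\<bar> \<le> \<eta>"
proof -
  have ct: "continuous_on {0..T} (\<lambda>x. tent e (x - a))"
    by (rule continuous_on_compose2[OF continuous_on_tent[of UNIV]]) (auto intro!: continuous_intros)
  have "((\<lambda>x. tent e (x - a)) has_integral smooth_step e (T - a) - smooth_step e (0 - a)) {0..T}"
  proof (rule fundamental_theorem_of_calculus)
    show "0 \<le> T" using e by simp
    fix x
    have "((\<lambda>x. x - a) has_real_derivative 1) (at x within {0..T})"
      by (auto intro!: derivative_eq_intros)
    from DERIV_chain'[OF this DERIV_smooth_step[of e _ UNIV]]
    show "((\<lambda>x. smooth_step e (x - a)) has_vector_derivative tent e (x - a)) (at x within {0..T})"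
      by (simp add: has_real_derivative_iff_has_vector_derivative[symmetric])
  qed
  then have one: "((\<lambda>x. tent e (x - a)) has_integral 1) {0..T}"
    using e by (simp add: smooth_step_0 smooth_step_1)
  have "(\<lambda>x. U x * tent e (x - a)) integrable_on {0..T}"
    by (intro integrable_continuous_real continuous_on_mult U ct)
  from has_integral_diff[OF integrable_integral[OF this] has_integral_mult_right[OF one, of c]]
  have "((\<lambda>x. (U x - c) * tent e (x - a)) has_integral
      integral {0..T} (\<lambda>x. U x * tent e (x - a)) - c) {0..T}"
    by (simp add: algebra_simps)
  moreover have "((\<lambda>x. \<eta> * tent e (x - a)) has_integral \<eta>) {0..T}"
    using has_integral_mult_right[OF one, of \<eta>] by simp
  moreover have "norm ((U x - c) * tent e (x - a)) \<le> \<eta> * tent e (x - a)" for x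
  proof (cases "x \<in> {a..a + e}")
    case True
    then show ?thesis using near[of x] tent_nonneg[OF e(1), of "x - a"]
      by (auto simp: abs_mult intro: mult_right_mono)
  next
    case False
    then show ?thesis using tent_eq_0[OF e(1), of "x - a"] by auto
  qed
  ultimately show ?thesis
    using integral_norm_bound_integral[of "\<lambda>x. (U x - c) * tent e (x - a)" "{0..T}" "\<lambda>x. \<eta> * tent e (x - a)"]
    by (auto simp: has_integral_iff)
qed

section \<open>Integrability and increments of elements of the periodic Sobolev space\<close>

lemma set_integrable_Ioo_iff_Icc:
  fixes f :: "real \<Rightarrow> real"
  shows "set_integrable lebesgue {a<..<b} f \<longleftrightarrow> set_integrable lebesgue {a..b} f"
  by (rule absolutely_integrable_on_Icc_iff_Ioo[symmetric])

lemma set_lebesgue_integral_Ioo: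
  fixes f :: "real \<Rightarrow> real"
  assumes "set_integrable lebesgue {a..b} f"
  shows "(LINT x:{a<..<b}|lebesgue. f x) = integral {a..b} f"
  using assms set_lebesgue_integral_eq_integral(2)[of "{a<..<b}" f]
  by (simp add: set_integrable_Ioo_iff_Icc integral_open_interval_real)

lemma set_integrable_continuous:
  fixes f :: "real \<Rightarrow> real"
  shows "continuous_on {a..b} f \<Longrightarrow> set_integrable lebesgue {a..b} f"
  using absolutely_integrable_continuous[of a b f] by simp

lemma W1p_per_integrable:
  assumes "(U, U') \<in> W1p_per T p" "1 < p"
  shows "set_integrable lebesgue {0..T} (\<lambda>x. \<bar>U' x\<bar> powr p)"
    and "set_integrable lebesgue {0..T} (\<lambda>x. \<bar>U' x\<bar>)"
proof -
  from assms have m: "set_borel_measurable lebesgue {0<..<T} U'"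
    and i: "set_integrable lebesgue {0<..<T} (\<lambda>x. \<bar>U' x\<bar> powr p)"
    by (auto simp: W1p_per_def Lp_on_def)
  from i show "set_integrable lebesgue {0..T} (\<lambda>x. \<bar>U' x\<bar> powr p)"
    by (simp add: set_integrable_Ioo_iff_Icc)
  have "set_integrable lebesgue {0<..<T} (\<lambda>x. 1 :: real)"
    using set_integrable_continuous[of 0 T "\<lambda>x. 1"] by (simp add: set_integrable_Ioo_iff_Icc)
  from set_integral_add(1)[OF this i]
  have "set_integrable lebesgue {0<..<T} (\<lambda>x. 1 + \<bar>U' x\<bar> powr p)" .
  then have "set_integrable lebesgue {0<..<T} U'"
  proof (rule set_integrable_bound[OF _ m AE_I2], intro impI)
    fix x
    have "\<bar>U' x\<bar> \<le> 1 + \<bar>U' x\<bar> powr p"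
    proof (cases "\<bar>U' x\<bar> \<le> 1")
      case True
      then show ?thesis using powr_ge_zero[of "\<bar>U' x\<bar>" p] by linarith
    next
      case False
      then have "\<bar>U' x\<bar> powr 1 \<le> \<bar>U' x\<bar> powr p" using assms(2) by (intro powr_mono) auto
      then show ?thesis using False by simp
    qed
    then show "norm (U' x) \<le> norm (1 + \<bar>U' x\<bar> powr p)" by simp
  qed
  from set_integrable_abs[OF this] show "set_integrable lebesgue {0..T} (\<lambda>x. \<bar>U' x\<bar>)"
    by (simp add: set_integrable_Ioo_iff_Icc)
qed

text \<open>The weak derivative is tested with a \<open>C1\<close> approximation \<open>h\<close> of
  the indicator of the interval from \<open>s\<close> to \<open>t\<close>. Its derivative is a
  difference of two tents, which average \<open>U\<close> near \<open>s\<close> and near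
  \<open>t\<close>, while \<open>h\<close> is bounded by 1 and supported inside the
  interval.\<close>

lemma W1p_per_increment_le:
  assumes W: "(U, U') \<in> W1p_per T p" and p: "1 < p" and st: "0 \<le> s" "s \<le> t" "t \<le> T"
  shows "\<bar>U t - U s\<bar> \<le> integral {s..t} (\<lambda>x. \<bar>U' x\<bar>)"
proof (cases "s = t")
  case False
  with st have "s < t" by simp
  have U: "continuous_on {0..T} U" and wd: "weak_deriv_on {0<..<T} U U'"
    using W by (auto simp: W1p_per_def)
  have int: "set_integrable lebesgue {s..t} (\<lambda>x. \<bar>U' x\<bar>)"
    using set_integrable_subset[OF W1p_per_integrable(2)[OF W p]] st by simp
  have "\<bar>U t - U s\<bar> \<le> integral {s..t} (\<lambda>x. \<bar>U' x\<bar>) + 2 * \<eta>" if eta: "0 < \<eta>" for \<eta>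
  proof -
    have "uniformly_continuous_on {0..T} U"
      by (rule compact_uniformly_continuous[OF U]) simp
    then obtain d where d: "0 < d"
      "\<And>x y. x \<in> {0..T} \<Longrightarrow> y \<in> {0..T} \<Longrightarrow> dist y x < d \<Longrightarrow> dist (U y) (U x) < \<eta>"
      unfolding uniformly_continuous_on_def using eta by metis
    \<comment> \<open>The tents occupy \<open>{s + e..s + 2 * e}\<close> and
      \<open>{t - 2 * e..t - e}\<close>: disjoint up to an endpoint, closer than \<open>d\<close> to
      \<open>s\<close> and \<open>t\<close>, and away from 0 and \<open>T\<close> even if
      \<open>s = 0\<close> or \<open>t = T\<close>.\<close>
    define e where "e = min (d / 3) ((t - s) / 4)"
    have e: "0 < e" "2 * e < d" "4 * e \<le> t - s" using d(1) \<open>s < t\<close> by (auto simp: e_def min_def)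
    define h where "h x = smooth_step e (x - (s + e)) - smooth_step e (x - (t - 2 * e))" for x
    define h' where "h' x = tent e (x - (s + e)) - tent e (x - (t - 2 * e))" for x
    have Dh: "(h has_real_derivative h' x) (at x)" for x
    proof -
      have "((\<lambda>x. smooth_step e (x - c)) has_real_derivative tent e (x - c)) (at x)" for c
      proof -
        have "((\<lambda>x. x - c) has_real_derivative 1) (at x)"
          by (auto intro!: derivative_eq_intros)
        from DERIV_chain'[OF this DERIV_smooth_step[of e _ UNIV]] show ?thesis by simp
      qed
      from DERIV_diff[OF this this] show ?thesis unfolding h_def[abs_def] h'_def .
    qed
    have ch': "continuous_on S h'" for S
      unfolding h'_def[abs_def]
      by (intro continuous_on_diff continuous_on_compose2[OF continuous_on_tent[of UNIV]] continuous_intros) auto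
    have h0: "h x = 0" if "x \<notin> {s + e..t - e}" for x
      using that e by (auto simp: h_def smooth_step_0 smooth_step_1)
    have h1: "\<bar>h x\<bar> \<le> 1" for x
      using smooth_step_bounds[OF e(1), of "x - (s + e)"] smooth_step_bounds[OF e(1), of "x - (t - 2 * e)"]
      by (auto simp: h_def abs_le_iff)
    have "h \<in> C1c {0<..<T}"
      unfolding C1c_def
    proof (intro CollectI conjI exI[of _ "{s + e..t - e}"])
      show "h C1_differentiable_on UNIV"
        unfolding C1_differentiable_on_def
        using Dh ch' by (auto simp: has_real_derivative_iff_has_vector_derivative[symmetric])
    qed (use e st h0 in auto)
    with wd have "(LINT x:{0<..<T}|lebesgue. U x * deriv h x) = - (LINT x:{0<..<T}|lebesgue. U' x * h x)"
      by (simp add: weak_deriv_on_def)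
    moreover have "deriv h = h'" using Dh by (auto intro: DERIV_imp_deriv)
    ultimately have "(LINT x:{0<..<T}|lebesgue. U x * h' x) = - (LINT x:{0<..<T}|lebesgue. U' x * h x)"
      by simp
    moreover have "(LINT x:{0<..<T}|lebesgue. U x * h' x) = integral {0..T} (\<lambda>x. U x * h' x)"
      by (intro set_lebesgue_integral_Ioo set_integrable_continuous continuous_on_mult U ch')
    moreover have "\<bar>LINT x:{0<..<T}|lebesgue. U' x * h x\<bar> \<le> integral {s..t} (\<lambda>x. \<bar>U' x\<bar>)"
    proof -
      have "\<bar>LINT x:{0<..<T}|lebesgue. U' x * h x\<bar>
          \<le> (LINT x|lebesgue. norm (indicator {0<..<T} x *\<^sub>R (U' x * h x)))"
        unfolding set_lebesgue_integral_def using integral_norm_bound by fastforce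
      also have "\<dots> \<le> (LINT x|lebesgue. indicator {s..t} x *\<^sub>R \<bar>U' x\<bar>)"
      proof (rule integral_mono')
        show "integrable lebesgue (\<lambda>x. indicator {s..t} x *\<^sub>R \<bar>U' x\<bar>)"
          using int by (simp add: set_integrable_def)
        fix x
        show "norm (indicator {0<..<T} x *\<^sub>R (U' x * h x)) \<le> indicator {s..t} x *\<^sub>R \<bar>U' x\<bar>"
          using h0[of x] mult_left_mono[OF h1[of x], of "\<bar>U' x\<bar>"] e(1)
          by (cases "x \<in> {s + e..t - e}") (auto simp: indicator_def abs_mult)
      qed auto
      also have "\<dots> = integral {s..t} (\<lambda>x. \<bar>U' x\<bar>)"
        using set_lebesgue_integral_eq_integral(2)[OF int] by (simp add: set_lebesgue_integral_def)
      finally show ?thesis .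
    qed
    moreover have "integral {0..T} (\<lambda>x. U x * h' x)
        = integral {0..T} (\<lambda>x. U x * tent e (x - (s + e))) - integral {0..T} (\<lambda>x. U x * tent e (x - (t - 2 * e)))"
      unfolding h'_def right_diff_distrib
      by (intro Henstock_Kurzweil_Integration.integral_diff integrable_continuous_real continuous_on_mult U
          continuous_on_compose2[OF continuous_on_tent[of UNIV]] continuous_intros) auto
    moreover have "\<bar>integral {0..T} (\<lambda>x. U x * tent e (x - (s + e))) - U s\<bar> \<le> \<eta>"
    proof (rule integral_times_tent[OF U e(1)])
      fix x assume "x \<in> {s + e..s + e + e}"
      then show "\<bar>U x - U s\<bar> \<le> \<eta>"
        using d(2)[of s x] e st by (auto simp: dist_real_def)
    qed (use e st in auto)
    moreover have "\<bar>integral {0..T} (\<lambda>x. U x * tent e (x - (t - 2 * e))) - U t\<bar> \<le> \<eta>"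
    proof (rule integral_times_tent[OF U e(1)])
      fix x assume "x \<in> {t - 2 * e..t - 2 * e + e}"
      then show "\<bar>U x - U t\<bar> \<le> \<eta>"
        using d(2)[of t x] e st by (auto simp: dist_real_def)
    qed (use e st in auto)
    ultimately show ?thesis by linarith
  qed
  then have "\<bar>U t - U s\<bar> \<le> integral {s..t} (\<lambda>x. \<bar>U' x\<bar>) + e" if "0 < e" for e
    using that half_gt_zero[OF that] by fastforce
  then show ?thesis by (rule field_le_epsilon)
qed simp

section \<open>Picone's inequality\<close>

lemma mvt_Icc:
  fixes f :: "real \<Rightarrow> real"
  assumes "a < b" "{a..b} \<subseteq> S"
    and f: "\<And>x. x \<in> S \<Longrightarrow> (f has_real_derivative f' x) (at x within S)"
  obtains \<xi> where "\<xi> \<in> {a<..<b}" "f b - f a = (b - a) * f' \<xi>"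
proof -
  have "\<exists>\<xi>\<in>{a<..<b}. f b - f a = (b - a) * f' \<xi>"
  proof (rule mvt_simple[OF \<open>a < b\<close>, of f "\<lambda>x h. h * f' x"])
    fix x assume "a \<le> x" "x \<le> b"
    then have "(f has_real_derivative f' x) (at x within {a..b})"
      using DERIV_subset[OF f assms(2)] assms(2) by auto
    then show "(f has_derivative (\<lambda>h. h * f' x)) (at x within {a..b})"
      by (simp add: has_field_derivative_def mult_commute_abs)
  qed
  then show thesis using that by blast
qed

text \<open>Cut \<open>{0..T}\<close> into equal steps shorter than \<open>d\<close>; the losses add
  up to \<open>e * T\<close>. Monotonicity is thus obtained without differentiating
  \<open>G\<close>.\<close>

lemma nondecreasing_if_almost:
  fixes G :: "real \<Rightarrow> real"
  assumes T: "0 < T"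
    and G: "\<And>e. 0 < e \<Longrightarrow> \<exists>d>0. \<forall>s t. 0 \<le> s \<and> s \<le> t \<and> t \<le> T \<and> t - s < d \<longrightarrow> G s - e * (t - s) \<le> G t"
  shows "G 0 \<le> G T"
proof (rule field_le_epsilon)
  fix e' :: real assume "0 < e'"
  define e where "e = e' / T"
  have e: "0 < e" "e * T = e'" using \<open>0 < e'\<close> T by (auto simp: e_def)
  obtain d where d: "0 < d"
    "\<And>s t. 0 \<le> s \<Longrightarrow> s \<le> t \<Longrightarrow> t \<le> T \<Longrightarrow> t - s < d \<Longrightarrow> G s - e * (t - s) \<le> G t"
    using G[OF e(1)] by metis
  obtain n where n: "T / d < real n" using reals_Archimedean2 by blast
  define h where "h = T / real n"
  have n0: "0 < real n" using n T d(1) by (meson divide_pos_pos less_trans)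
  have h: "0 < h" "h < d" "real n * h = T"
    using n n0 T d(1) by (auto simp: h_def field_simps)
  have "k \<le> n \<Longrightarrow> G 0 - e * (real k * h) \<le> G (real k * h)" for k
  proof (induction k)
    case (Suc k)
    have "real (Suc k) * h \<le> real n * h" using Suc.prems h by (intro mult_right_mono) auto
    then have "G (real k * h) - e * (real (Suc k) * h - real k * h) \<le> G (real (Suc k) * h)"
      using h by (intro d(2)) (auto simp: algebra_simps)
    with Suc show ?case by (simp add: algebra_simps)
  qed simp
  from this[of n] h(3) e(2) show "G 0 \<le> G T + e'" by simp
qed

text \<open>The two factors are evaluated at different points, because increments of a product
  combine mean value points of one factor with endpoints of the other.\<close>

lemma uniformly_continuous_product:
  fixes f g :: "real \<Rightarrow> real"
  assumes "continuous_on {0..T} f" "continuous_on {0..T} g" "0 < e"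
  obtains d where "0 < d"
    "\<And>x y x' y'. {x, y, x', y'} \<subseteq> {0..T} \<Longrightarrow> \<bar>x - x'\<bar> < d \<Longrightarrow> \<bar>y - y'\<bar> < d \<Longrightarrow>
      \<bar>f x * g y - f x' * g y'\<bar> < e"
proof -
  have "continuous_on ({0..T} \<times> {0..T}) (\<lambda>z. f (fst z) * g (snd z))"
    by (intro continuous_on_mult continuous_on_compose2[OF assms(1)] continuous_on_compose2[OF assms(2)]
        continuous_on_fst continuous_on_snd continuous_on_id) auto
  then have "uniformly_continuous_on ({0..T} \<times> {0..T}) (\<lambda>z. f (fst z) * g (snd z))"
    by (rule compact_uniformly_continuous) (intro compact_Times compact_Icc)
  then obtain d where d: "0 < d"
    "\<And>z z'. z \<in> {0..T} \<times> {0..T} \<Longrightarrow> z' \<in> {0..T} \<times> {0..T} \<Longrightarrow> dist z' z < d \<Longrightarrow>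
      dist (f (fst z') * g (snd z')) (f (fst z) * g (snd z)) < e"
    unfolding uniformly_continuous_on_def using assms(3) by metis
  show thesis
  proof (rule that[of "d / 2"])
    fix x y x' y' assume *: "{x, y, x', y'} \<subseteq> {0..T}" "\<bar>x - x'\<bar> < d / 2" "\<bar>y - y'\<bar> < d / 2"
    have "dist (x, y) (x', y') \<le> \<bar>x - x'\<bar> + \<bar>y - y'\<bar>"
      using norm_Pair_le[of "x - x'" "y - y'"] by (simp add: dist_norm)
    then have "dist (x, y) (x', y') < d" using * by linarith
    with d(2)[of "(x', y')" "(x, y)"] * show "\<bar>f x * g y - f x' * g y'\<bar> < e"
      by (simp add: dist_real_def)
  qed (use d in auto)
qed

text \<open>Picone's inequality in Riccati form: \<open>w\<close> plays the role of \<open>\<phi>\<^sub>p(u')/\<phi>\<^sub>p(u)\<close> for a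
  positive periodic \<open>u\<close>. Since \<open>U\<close> is only weakly differentiable, the proof shows that the defect
  \<open>G\<close> is nondecreasing by comparing its increments over short intervals.\<close>

lemma Picone_W1p_per:
  assumes T: "0 < T" and p: "1 < p" and W: "(U, U') \<in> W1p_per T p"
    and d: "continuous_on {0..T} d"
    and w: "\<And>x. x \<in> {0..T} \<Longrightarrow>
      (w has_real_derivative d x - (p - 1) * (w x * phi (p / (p - 1)) (w x))) (at x within {0..T})"
    and per: "w 0 = w T"
  shows "0 \<le> (LINT x:{0<..<T}|lebesgue. \<bar>U' x\<bar> powr p + d x * \<bar>U x\<bar> powr p)"
proof -
  let ?q = "p / (p - 1)"
  define V where "V x = \<bar>U x\<bar> powr p" for x
  define P where "P x = \<bar>w x\<bar> powr ?q" for x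
  have q: "0 < ?q" using p by simp
  have U: "continuous_on {0..T} U" "U 0 = U T" using W by (auto simp: W1p_per_def)
  have cV: "continuous_on {0..T} V"
    unfolding V_def[abs_def] using p by (intro continuous_on_powr' continuous_intros U) auto
  have cw: "continuous_on {0..T} w" using w by (rule DERIV_continuous_on)
  have cP: "continuous_on {0..T} P"
    unfolding P_def[abs_def] using q by (intro continuous_on_powr' continuous_intros cw) auto
  have dV: "(\<lambda>x. d x * V x) integrable_on {0..T}"
    by (intro integrable_continuous_real continuous_on_mult d cV)
  have U'p: "(\<lambda>x. \<bar>U' x\<bar> powr p) integrable_on {0..T}" and U'1: "(\<lambda>x. \<bar>U' x\<bar>) integrable_on {0..T}"
    using W1p_per_integrable[OF W p] by (auto intro: set_lebesgue_integral_eq_integral)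
  define I where "I x = \<bar>U' x\<bar> powr p + d x * V x" for x
  \<comment> \<open>Formally the derivative of \<open>G\<close> is
    \<open>\<bar>U'\<bar> powr p - w * V' + (p - 1) * P * V\<close>, since \<open>d\<close> cancels;
    it is nonnegative by \<open>Young_powr\<close>.\<close>
  define G where "G x = integral {0..x} I - w x * V x" for x
  have I: "I integrable_on {0..T}" unfolding I_def[abs_def] by (intro integrable_add U'p dV)
  have "G 0 \<le> G T"
  proof (rule nondecreasing_if_almost[OF T])
    fix e :: real assume "0 < e"
    \<comment> \<open>Moving the evaluation points costs \<open>e / p\<close> for
      \<open>d * V\<close> and \<open>(p - 1) * (e / p)\<close> for \<open>P * V\<close>, together
      \<open>e\<close>.\<close>
    then have e: "0 < e / p" using p by simp
    obtain d1 where d1: "0 < d1" "\<And>x y x' y'. {x, y, x', y'} \<subseteq> {0..T} \<Longrightarrow> \<bar>x - x'\<bar> < d1 \<Longrightarrow> \<bar>y - y'\<bar> < d1 \<Longrightarrow>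
      \<bar>d x * V y - d x' * V y'\<bar> < e / p" by (rule uniformly_continuous_product[OF d cV e]) (rule that)
    obtain d2 where d2: "0 < d2" "\<And>x y x' y'. {x, y, x', y'} \<subseteq> {0..T} \<Longrightarrow> \<bar>x - x'\<bar> < d2 \<Longrightarrow> \<bar>y - y'\<bar> < d2 \<Longrightarrow>
      \<bar>P x * V y - P x' * V y'\<bar> < e / p" by (rule uniformly_continuous_product[OF cP cV e]) (rule that)
    show "\<exists>d>0. \<forall>s t. 0 \<le> s \<and> s \<le> t \<and> t \<le> T \<and> t - s < d \<longrightarrow> G s - e * (t - s) \<le> G t"
    proof (intro exI[of _ "min d1 d2"] conjI allI impI)
      fix s t assume st: "0 \<le> s \<and> s \<le> t \<and> t \<le> T \<and> t - s < min d1 d2"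
      show "G s - e * (t - s) \<le> G t"
      proof (cases "s = t")
        case False
        with st have "s < t" by simp
        have sub: "{s..t} \<subseteq> {0..T}" using st by auto
        obtain \<xi> where \<xi>: "\<xi> \<in> {s<..<t}"
          and "w t - w s = (t - s) * (d \<xi> - (p - 1) * (w \<xi> * phi ?q (w \<xi>)))"
          by (rule mvt_Icc[OF \<open>s < t\<close> sub w]) (assumption, rule that)
        then have wt: "w t - w s = (t - s) * (d \<xi> - (p - 1) * P \<xi>)"
          by (simp add: P_def times_phi)
        have wdiff: "(w t - w s) * V t = (t - s) * (d \<xi> * V t) - (t - s) * ((p - 1) * (P \<xi> * V t))"
          unfolding wt by (simp add: algebra_simps)
        \<comment> \<open>The endpoint at which the modulus of \<open>U\<close> is larger carries
          the bound for the increment of \<open>V\<close>.\<close>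
        obtain \<eta> where \<eta>: "\<eta> \<in> {s, t}" "max \<bar>U s\<bar> \<bar>U t\<bar> = \<bar>U \<eta>\<bar>"
          by (metis insertCI max_def)
        let ?K = "p * \<bar>w s\<bar> * \<bar>U \<eta>\<bar> powr (p - 1)"
        have K0: "0 \<le> ?K" using p by simp
        have i1: "(\<lambda>x. \<bar>U' x\<bar>) integrable_on {s..t}" and ip: "(\<lambda>x. \<bar>U' x\<bar> powr p) integrable_on {s..t}"
          and id: "(\<lambda>x. d x * V x) integrable_on {s..t}"
          using U'1 U'p dV sub by (auto intro: integrable_subinterval_real)
        have "\<bar>w s * (V t - V s)\<bar> \<le> \<bar>w s\<bar> * (p * \<bar>U \<eta>\<bar> powr (p - 1) * \<bar>U t - U s\<bar>)"
          unfolding abs_mult V_def \<eta>(2)[symmetric] by (intro mult_left_mono abs_powr_diff_le p) auto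
        also have "\<dots> = ?K * \<bar>U t - U s\<bar>" by simp
        also have "\<dots> \<le> ?K * integral {s..t} (\<lambda>x. \<bar>U' x\<bar>)"
          using W1p_per_increment_le[OF W p, of s t] st K0 by (intro mult_left_mono) auto
        also have "\<dots> = integral {s..t} (\<lambda>x. ?K * \<bar>U' x\<bar>)" by simp
        also have "\<dots> \<le> integral {s..t} (\<lambda>x. \<bar>U' x\<bar> powr p + (p - 1) * (P s * V \<eta>))"
        proof (rule integral_le)
          show "(\<lambda>x. ?K * \<bar>U' x\<bar>) integrable_on {s..t}"
            using integrable_on_cmult_left[OF i1, of ?K] by simp
          show "(\<lambda>x. \<bar>U' x\<bar> powr p + (p - 1) * (P s * V \<eta>)) integrable_on {s..t}"
            by (intro integrable_add ip integrable_const_ivl)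
        qed (use Young_powr[OF p] in \<open>simp add: P_def V_def\<close>)
        also have "\<dots> = integral {s..t} (\<lambda>x. \<bar>U' x\<bar> powr p) + (t - s) * ((p - 1) * (P s * V \<eta>))"
          using st by (subst Henstock_Kurzweil_Integration.integral_add[OF ip integrable_const_ivl]) simp
        finally have wV: "\<bar>w s * (V t - V s)\<bar> \<le> \<dots>" .
        have "(t - s) * (d \<xi> * V t - e / p) = integral {s..t} (\<lambda>x. d \<xi> * V t - e / p)"
          using st by simp
        also have "\<dots> \<le> integral {s..t} (\<lambda>x. d x * V x)"
        proof (rule integral_le[OF integrable_const_ivl id])
          fix x assume "x \<in> {s..t}"
          then have "{\<xi>, t, x, x} \<subseteq> {0..T}" "\<bar>\<xi> - x\<bar> < d1" "\<bar>t - x\<bar> < d1"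
            using \<xi> st by (auto simp: abs_less_iff)
          from d1(2)[OF this] show "d \<xi> * V t - e / p \<le> d x * V x" by linarith
        qed
        finally have dV': "(t - s) * (d \<xi> * V t - e / p) \<le> integral {s..t} (\<lambda>x. d x * V x)" .
        have "{s, \<eta>, \<xi>, t} \<subseteq> {0..T}" "\<bar>s - \<xi>\<bar> < d2" "\<bar>\<eta> - t\<bar> < d2"
          using \<xi> \<eta>(1) st d2(1) by (auto simp: abs_less_iff)
        from d2(2)[OF this] have "P s * V \<eta> - P \<xi> * V t \<le> e / p" by linarith
        then have "(t - s) * ((p - 1) * (P s * V \<eta> - P \<xi> * V t)) \<le> (t - s) * ((p - 1) * (e / p))"
          using p st by (intro mult_left_mono) auto
        then have PV: "(t - s) * ((p - 1) * (P s * V \<eta>)) - (t - s) * ((p - 1) * (P \<xi> * V t)) \<le> (t - s) * ((p - 1) * (e / p))"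
          by (simp only: right_diff_distrib)
        have "G t - G s = integral {s..t} I - (w t - w s) * V t - w s * (V t - V s)"
          using Henstock_Kurzweil_Integration.integral_combine[of 0 s t I] integrable_subinterval_real[OF I, of 0 t] st
          by (simp add: G_def algebra_simps)
        also have "integral {s..t} I = integral {s..t} (\<lambda>x. \<bar>U' x\<bar> powr p) + integral {s..t} (\<lambda>x. d x * V x)"
          unfolding I_def by (rule Henstock_Kurzweil_Integration.integral_add[OF ip id])
        finally have "G t - G s \<ge> (t - s) * (d \<xi> * V t - e / p) - (t - s) * (d \<xi> * V t) - (t - s) * ((p - 1) * (e / p))"
          using wV dV' PV wdiff by linarith
        also have "(t - s) * (d \<xi> * V t - e / p) - (t - s) * (d \<xi> * V t) - (t - s) * ((p - 1) * (e / p)) = - (t - s) * e"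
          using p by (simp add: field_simps)
        finally show ?thesis by (simp add: algebra_simps)
      qed simp
    qed (use d1 d2 in auto)
  qed
  \<comment> \<open>The boundary terms \<open>w * V\<close> at 0 and \<open>T\<close> are equal by
    periodicity and cancel.\<close>
  then have "0 \<le> integral {0..T} I" using U(2) per by (simp add: G_def V_def)
  moreover have "(LINT x:{0<..<T}|lebesgue. I x) = integral {0..T} I"
    unfolding I_def
    by (intro set_lebesgue_integral_Ioo set_integral_add W1p_per_integrable[OF W p]
        set_integrable_continuous continuous_on_mult d cV)
  ultimately show ?thesis by (simp add: I_def V_def)
qed

section \<open>Periodic Riccati systems\<close>

text \<open>A maximum at 0 only yields a nonpositive one-sided derivative; periodicity lets it be
  moved to \<open>T\<close>. At a maximum in the half-open interval from 0 (excluded) to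
  \<open>T\<close>, approach from the left gives the sign.\<close>

lemma periodic_max_derivative_nonneg:
  fixes w :: "real \<Rightarrow> real"
  assumes "0 < T" "w 0 = w T"
    and w: "\<And>x. x \<in> {0..T} \<Longrightarrow> (w has_real_derivative w' x) (at x within {0..T})"
  obtains s where "s \<in> {0..T}" "\<And>x. x \<in> {0..T} \<Longrightarrow> w x \<le> w s" "0 \<le> w' s"
proof -
  have "continuous_on {0..T} w" using w by (rule DERIV_continuous_on)
  then obtain s0 where s0: "s0 \<in> {0..T}" "\<And>x. x \<in> {0..T} \<Longrightarrow> w x \<le> w s0"
    using continuous_attains_sup[of "{0..T}" w] assms(1) by auto
  define s where "s = (if s0 = 0 then T else s0)"
  have s: "s \<in> {0..T}" "0 < s" and max: "\<And>x. x \<in> {0..T} \<Longrightarrow> w x \<le> w s"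
    using s0 assms(1,2) by (auto simp: s_def)
  have "0 \<le> w' s"
  proof (rule ccontr)
    assume "\<not> 0 \<le> w' s"
    then obtain d where d: "0 < d" "\<forall>h>0. s - h \<in> {0..T} \<longrightarrow> h < d \<longrightarrow> w s < w (s - h)"
      using has_real_derivative_neg_dec_left[OF w[OF s(1)]] by auto
    define h where "h = min (d / 2) s"
    have "0 < h" "h < d" "s - h \<in> {0..T}" using d(1) s by (auto simp: h_def min_def)
    then show False using d(2) max[of "s - h"] by force
  qed
  then show thesis using that s(1) max by blast
qed

text \<open>The mirror image: a minimum at \<open>T\<close> is moved to 0 and approached from the
  right. The sign agrees with that at the maximum, so one estimate for the Riccati equation serves
  both extrema.\<close>

lemma periodic_min_derivative_nonneg:
  fixes w :: "real \<Rightarrow> real"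
  assumes "0 < T" "w 0 = w T"
    and w: "\<And>x. x \<in> {0..T} \<Longrightarrow> (w has_real_derivative w' x) (at x within {0..T})"
  obtains s where "s \<in> {0..T}" "\<And>x. x \<in> {0..T} \<Longrightarrow> w s \<le> w x" "0 \<le> w' s"
proof -
  have "continuous_on {0..T} w" using w by (rule DERIV_continuous_on)
  then obtain s0 where s0: "s0 \<in> {0..T}" "\<And>x. x \<in> {0..T} \<Longrightarrow> w s0 \<le> w x"
    using continuous_attains_inf[of "{0..T}" w] assms(1) by auto
  define s where "s = (if s0 = T then 0 else s0)"
  have s: "s \<in> {0..T}" "s < T" and min: "\<And>x. x \<in> {0..T} \<Longrightarrow> w s \<le> w x"
    using s0 assms(1,2) by (auto simp: s_def)
  have "0 \<le> w' s"
  proof (rule ccontr)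
    assume "\<not> 0 \<le> w' s"
    then obtain d where d: "0 < d" "\<forall>h>0. s + h \<in> {0..T} \<longrightarrow> h < d \<longrightarrow> w (s + h) < w s"
      using has_real_derivative_neg_dec_right[OF w[OF s(1)]] by auto
    define h where "h = min (d / 2) (T - s)"
    have "0 < h" "h < d" "s + h \<in> {0..T}" using d(1) s by (auto simp: h_def min_def)
    then show False using d(2) min[of "s + h"] by force
  qed
  then show thesis using that s(1) min by blast
qed

section \<open>Periodic solutions of the truncated system by clipping the unknowns\<close>

definition clip :: "real \<Rightarrow> real \<Rightarrow> real" where
  "clip R x = max (- R) (min R x)"

lemma clip_in: "0 \<le> R \<Longrightarrow> clip R x \<in> {-R..R}"
  by (auto simp: clip_def)

lemma continuous_on_clip [continuous_intros]:
  "continuous_on S f \<Longrightarrow> continuous_on S (\<lambda>x. clip R (f x))"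
  unfolding clip_def by (intro continuous_intros)

lemma clip_fixed: "x \<in> {-R..R} \<Longrightarrow> clip R x = x"
  by (auto simp: clip_def)

text \<open>A fixed point of a projected step is a complementarity condition: the increment vanishes
  unless it pushes outwards at an end of the interval.\<close>

lemma clip_add_fixed:
  "0 \<le> R \<Longrightarrow> clip R (x + d) = x \<Longrightarrow> d = 0 \<or> x = R \<and> 0 < d \<or> x = - R \<and> d < 0"
  by (auto simp: clip_def max_def min_def split: if_splits)

text \<open>The truncation keeps the identity \<open>(w e\<^bsup>(p-1)v\<^esup>)' = e\<^bsup>(p-1)v\<^esup> (a - c)\<close> intact: the same
  function \<open>P\<close> occurs in both equations.\<close>

lemma clipped_periodic_system:
  fixes a :: "real \<Rightarrow> real \<Rightarrow> real" and P :: "real \<Rightarrow> real"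
  assumes T: "0 < T" and p: "1 < p" and Rpos: "0 < R"
    and a: "continuous_on ({0..T} \<times> UNIV) (\<lambda>(t, v). a t v)"
    and aA: "\<And>t v. t \<in> {0..T} \<Longrightarrow> \<bar>a t v\<bar> \<le> A"
    and P: "continuous_on UNIV P" "\<And>s. \<bar>P s\<bar> \<le> B" "\<And>s. s * P s \<le> B'" "\<And>s. 0 \<le> s * P s"
  obtains v w :: "real \<Rightarrow> real" and c :: real
  where "\<And>x. x \<in> {0..T} \<Longrightarrow> (v has_real_derivative P (w x)) (at x within {0..T})"
    and "\<And>x. x \<in> {0..T} \<Longrightarrow>
      (w has_real_derivative a x (v x) - c - (p - 1) * (w x * P (w x))) (at x within {0..T})"
    and "v 0 = v T" "w 0 = w T"
    and "c = 0 \<or> v 0 = R \<and> 0 < c \<or> v 0 = - R \<and> c < 0"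
proof -
  have A0: "0 \<le> A" using order_trans[OF abs_ge_zero aA[of 0]] T by simp
  have B0: "0 \<le> B'" using order_trans[OF P(4) P(3)] .
  \<comment> \<open>Large enough that \<open>c = C\<close> forces \<open>w' < 0\<close> and
    \<open>c = - C\<close> forces \<open>w' > 0\<close> everywhere. Each contradicts the sign of
    \<open>w T - w 0\<close> that clipping would require there.\<close>
  define C where "C = A + (p - 1) * B' + 1"
  define D where "D = A + C + (p - 1) * B'"
  \<comment> \<open>\<open>D\<close> bounds the derivative of \<open>w\<close>, so
    \<open>w 0\<close> equal to plus or minus this constant makes \<open>w\<close> keep one sign on
    \<open>{0..T}\<close>. Then \<open>v\<close> is monotone in the direction that the clipped
    condition for \<open>w 0\<close> excludes.\<close>
  define \<Omega> where "\<Omega> = D * T + 1"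
  have pB: "0 \<le> (p - 1) * B'" using p B0 by simp
  have C0: "0 < C" and D0: "0 \<le> D" using A0 pB unfolding C_def D_def by linarith+
  have \<Omega>0: "0 < \<Omega>" using D0 T by (simp add: \<Omega>_def add_nonneg_pos)
  have wP: "0 \<le> (p - 1) * (s * P s)" "(p - 1) * (s * P s) \<le> (p - 1) * B'" for s
    using p P(3,4)[of s] by (auto intro: mult_left_mono)
  \<comment> \<open>The parameter \<open>c\<close> becomes a third, constant component of the state;
    it is clipped to keep the field bounded.\<close>
  define F :: "real \<Rightarrow> real \<times> real \<times> real \<Rightarrow> real \<times> real \<times> real" where
    "F t z = (P (fst (snd z)),
      a t (fst z) - clip C (snd (snd z)) - (p - 1) * (fst (snd z) * P (fst (snd z))), 0)" for t z
  \<comment> \<open>The unknowns are corrected crosswise: \<open>v 0\<close> by \<open>c\<close>,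
    \<open>w 0\<close> by the defect of \<open>v\<close>, and \<open>c\<close> by the defect of
    \<open>w\<close>. With these signs the bounds on \<open>w 0\<close> and \<open>c\<close> cannot
    be active with a nonzero defect, so only the bound \<open>R\<close> on \<open>v 0\<close> can
    interfere.\<close>
  define Q :: "real \<times> real \<times> real \<Rightarrow> real \<times> real \<times> real \<Rightarrow> real \<times> real \<times> real" where
    "Q y z = (clip R (fst y + snd (snd y)), clip \<Omega> (fst (snd y) + (fst y - fst z)),
      clip C (snd (snd y) + (fst (snd z) - fst (snd y))))" for y z
  define K where "K = {-R..R} \<times> {-\<Omega>..\<Omega>} \<times> {-C..C}"
  have contF: "continuous_on ({0..T} \<times> UNIV) (\<lambda>(t, z). F t z)"
  proof -
    have "continuous_on ({0..T} \<times> UNIV) (\<lambda>y. P (fst (snd (snd y))))"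
      by (rule continuous_on_compose2[OF P(1)]) (auto intro!: continuous_intros)
    moreover have "continuous_on ({0..T} \<times> UNIV) (\<lambda>y. case (fst y, fst (snd y)) of (t, v) \<Rightarrow> a t v)"
      by (rule continuous_on_compose2[OF a]) (auto intro!: continuous_intros)
    ultimately show ?thesis
      unfolding F_def case_prod_unfold by (auto intro!: continuous_intros)
  qed
  have boundF: "norm (F t z) \<le> B + D" if "t \<in> {0..T}" for t z
  proof -
    define e where "e = a t (fst z) - clip C (snd (snd z)) - (p - 1) * (fst (snd z) * P (fst (snd z)))"
    have "norm (F t z) \<le> \<bar>P (fst (snd z))\<bar> + (\<bar>e\<bar> + 0)"
      unfolding F_def e_def[symmetric]
      by (intro order_trans[OF norm_Pair_le] add_mono) (auto intro: order_trans[OF norm_Pair_le])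
    moreover have "\<bar>e\<bar> \<le> D"
      using aA[OF that, of "fst z"] clip_in[of C "snd (snd z)"] C0 wP[of "fst (snd z)"]
      unfolding e_def D_def by (auto simp: abs_le_iff)
    ultimately show ?thesis using P(2)[of "fst (snd z)"] by linarith
  qed
  have K: "compact K" "convex K" "K \<noteq> {}"
    unfolding K_def using Rpos \<Omega>0 C0 by (auto intro!: compact_Times convex_Times)
  have contQ: "continuous_on (K \<times> UNIV) (\<lambda>(y, z). Q y z)"
    unfolding Q_def case_prod_unfold by (intro continuous_intros)
  have QK: "Q y z \<in> K" for y z
    unfolding Q_def K_def using clip_in[of R] clip_in[of \<Omega>] clip_in[of C] Rpos \<Omega>0 C0
    by (auto simp del: atLeastAtMost_iff)
  obtain z where z: "\<And>t. t \<in> {0..T} \<Longrightarrow> (z has_vector_derivative F t (z t)) (at t within {0..T})"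
    and zK: "z 0 \<in> K" and zQ: "Q (z 0) (z T) = z 0"
    by (rule boundary_value_problem[OF T contF boundF K contQ QK]) (assumption, rule that)
  define v where "v t = fst (z t)" for t
  define w where "w t = fst (snd (z t))" for t
  define c where "c = snd (snd (z 0))"
  have v': "(v has_real_derivative P (w t)) (at t within {0..T})" if "t \<in> {0..T}" for t
    using bounded_linear.has_vector_derivative[OF bounded_linear_fst z[OF that]]
    by (simp add: has_real_derivative_iff_has_vector_derivative v_def[abs_def] w_def F_def)
  note snd' = bounded_linear.has_vector_derivative[OF bounded_linear_snd z]
  have "((\<lambda>t. snd (snd (z t))) has_real_derivative 0) (at t within {0..T})" if "t \<in> {0..T}" for t
    using bounded_linear.has_vector_derivative[OF bounded_linear_snd snd'[OF that]]
    by (simp add: has_real_derivative_iff_has_vector_derivative F_def)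
  from has_field_derivative_zero_constant[OF convex_closed_interval this]
  have c: "snd (snd (z t)) = c" if "t \<in> {0..T}" for t
    using that T unfolding c_def by (metis atLeastAtMost_iff less_imp_le order_refl)
  have cC: "c \<in> {-C..C}" and vK: "v 0 \<in> {-R..R}" and wK: "w 0 \<in> {-\<Omega>..\<Omega>}"
    using zK by (auto simp: K_def c_def v_def w_def)
  have w': "(w has_real_derivative a t (v t) - c - (p - 1) * (w t * P (w t))) (at t within {0..T})"
    if "t \<in> {0..T}" for t
    using bounded_linear.has_vector_derivative[OF bounded_linear_fst snd'[OF that]] c[OF that] clip_fixed[OF cC]
    by (simp add: has_real_derivative_iff_has_vector_derivative v_def w_def[abs_def] F_def)
  have fixp: "clip R (v 0 + c) = v 0" "clip \<Omega> (w 0 + (v 0 - v T)) = w 0" "clip C (c + (w T - w 0)) = c"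
    using zQ by (auto simp: Q_def v_def w_def c_def prod_eq_iff)
  have sub: "{0..T} \<subseteq> {0..T}" by simp
  have wper: "w T = w 0"
  proof (rule ccontr)
    assume "w T \<noteq> w 0"
    then consider "c = C" "0 < w T - w 0" | "c = - C" "w T - w 0 < 0"
      using clip_add_fixed[OF _ fixp(3)] C0 by auto
    then show False
    proof cases
      case 1
      obtain \<xi> where \<xi>: "\<xi> \<in> {0<..<T}" "w T - w 0 = (T - 0) * (a \<xi> (v \<xi>) - c - (p - 1) * (w \<xi> * P (w \<xi>)))"
        by (rule mvt_Icc[OF T sub w']) (assumption, rule that)
      have "a \<xi> (v \<xi>) - c - (p - 1) * (w \<xi> * P (w \<xi>)) < 0"
        using aA[of \<xi> "v \<xi>"] \<xi>(1) wP(1)[of "w \<xi>"] 1(1) pB by (auto simp: C_def)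
      with \<xi>(2) 1(2) T show False by (simp add: zero_less_mult_iff)
    next
      case 2
      obtain \<xi> where \<xi>: "\<xi> \<in> {0<..<T}" "w T - w 0 = (T - 0) * (a \<xi> (v \<xi>) - c - (p - 1) * (w \<xi> * P (w \<xi>)))"
        by (rule mvt_Icc[OF T sub w']) (assumption, rule that)
      have "0 < a \<xi> (v \<xi>) - c - (p - 1) * (w \<xi> * P (w \<xi>))"
        using aA[of \<xi> "v \<xi>"] \<xi>(1) wP(2)[of "w \<xi>"] 2(1) by (auto simp: C_def)
      with \<xi>(2) 2(2) T show False by (simp add: mult_less_0_iff)
    qed
  qed
  have wD: "\<bar>w t - w 0\<bar> \<le> D * T" if t: "t \<in> {0..T}" for t
  proof (cases "t = 0")
    case False
    with t have "0 < t" "{0..t} \<subseteq> {0..T}" by auto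
    then obtain \<xi> where \<xi>: "\<xi> \<in> {0<..<t}" "w t - w 0 = (t - 0) * (a \<xi> (v \<xi>) - c - (p - 1) * (w \<xi> * P (w \<xi>)))"
      by (rule mvt_Icc[OF _ _ w']) (assumption, rule that)
    have "\<bar>a \<xi> (v \<xi>) - c - (p - 1) * (w \<xi> * P (w \<xi>))\<bar> \<le> D"
      using aA[of \<xi> "v \<xi>"] \<xi>(1) t wP[of "w \<xi>"] cC by (auto simp: D_def abs_le_iff)
    then have "\<bar>w t - w 0\<bar> \<le> t * D" using \<open>0 < t\<close> \<xi>(2) by (simp add: abs_mult)
    also have "\<dots> \<le> D * T" using t D0 by (simp add: mult.commute mult_left_mono)
    finally show ?thesis .
  qed (use D0 T in auto)
  have vper: "v 0 = v T"
  proof (rule ccontr)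
    assume "v 0 \<noteq> v T"
    then consider "w 0 = \<Omega>" "v T < v 0" | "w 0 = - \<Omega>" "v 0 < v T"
      using clip_add_fixed[OF _ fixp(2)] \<Omega>0 by auto
    moreover obtain \<xi> where \<xi>: "\<xi> \<in> {0<..<T}" "v T - v 0 = (T - 0) * P (w \<xi>)"
      by (rule mvt_Icc[OF T sub v']) (assumption, rule that)
    ultimately show False
    proof cases
      case 1
      then have "0 < w \<xi>" using wD[of \<xi>] \<xi>(1) by (auto simp: \<Omega>_def abs_le_iff)
      with P(4)[of "w \<xi>"] have "0 \<le> P (w \<xi>)" by (simp add: zero_le_mult_iff)
      with \<xi>(2) 1(2) T show False by (metis diff_0_right diff_ge_0_iff_ge less_imp_le mult_nonneg_nonneg not_less)
    next
      case 2
      then have "w \<xi> < 0" using wD[of \<xi>] \<xi>(1) by (auto simp: \<Omega>_def abs_le_iff)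
      with P(4)[of "w \<xi>"] have "P (w \<xi>) \<le> 0" by (simp add: zero_le_mult_iff)
      then have "T * P (w \<xi>) \<le> 0" using T by (simp add: mult_le_0_iff)
      with \<xi>(2) 2(2) show False by simp
    qed
  qed
  show thesis
    by (rule that[OF v' w' vper wper[symmetric] clip_add_fixed[OF less_imp_le[OF Rpos] fixp(1)]])
qed

section \<open>Truncation of the nonlinearity in the Riccati system\<close>

definition trunc_phi :: "real \<Rightarrow> real \<Rightarrow> real \<Rightarrow> real" where
  "trunc_phi r M s = phi r s / (max 1 (\<bar>s\<bar> / M)) powr r"

lemma trunc_phi_eq: "0 < M \<Longrightarrow> \<bar>s\<bar> \<le> M \<Longrightarrow> trunc_phi r M s = phi r s"
  by (simp add: trunc_phi_def max_def)

lemma times_trunc_phi: "s * trunc_phi r M s = (\<bar>s\<bar> / max 1 (\<bar>s\<bar> / M)) powr r"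
  by (simp add: trunc_phi_def times_phi powr_divide)

text \<open>The damping factor has exponent \<open>r\<close> so that the quadratic-like term
  \<open>s * trunc_phi r M s\<close> freezes at its value for modulus \<open>M\<close>; this makes
  the equation for \<open>w\<close> bounded while keeping a fixed strength of damping at large
  \<open>w\<close>.\<close>

lemma times_trunc_phi_large: "0 < M \<Longrightarrow> M \<le> \<bar>s\<bar> \<Longrightarrow> s * trunc_phi r M s = M powr r"
  by (simp add: times_trunc_phi max_def)

lemma times_trunc_phi_le:
  assumes "0 < M" "0 < r"
  shows "s * trunc_phi r M s \<le> M powr r"
proof (cases "\<bar>s\<bar> \<le> M")
  case True
  then show ?thesis using assms by (auto simp: times_trunc_phi max_def intro: powr_mono2)
next
  case False
  then show ?thesis using times_trunc_phi_large[OF assms(1), of s r] by simp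
qed

lemma abs_trunc_phi_le:
  assumes M: "0 < M" and r: "1 < r"
  shows "\<bar>trunc_phi r M s\<bar> \<le> 1 + M powr r"
proof (cases "\<bar>s\<bar> \<le> 1")
  case True
  have *: "\<bar>phi r s\<bar> \<le> 1"
  proof (cases "s = 0")
    case False
    have "\<bar>phi r s\<bar> = phi r \<bar>s\<bar>" by (simp add: phi_def abs_mult)
    also have "\<dots> = \<bar>s\<bar> powr (r - 1)" using False by (simp add: phi_pos)
    also have "\<dots> \<le> 1" using True r powr_mono2[of "r - 1" "\<bar>s\<bar>" 1] by simp
    finally show ?thesis .
  qed simp
  have "1 \<le> (max 1 (\<bar>s\<bar> / M)) powr r" using r by (intro ge_one_powr_ge_zero) auto
  then have "\<bar>trunc_phi r M s\<bar> \<le> \<bar>phi r s\<bar>"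
    using divide_left_mono[of 1 "(max 1 (\<bar>s\<bar> / M)) powr r" "\<bar>phi r s\<bar>"] by (simp add: trunc_phi_def)
  with * show ?thesis using powr_ge_zero[of M r] by linarith
next
  case False
  have "0 \<le> s * trunc_phi r M s" by (simp add: times_trunc_phi)
  then have "\<bar>s\<bar> * \<bar>trunc_phi r M s\<bar> \<le> M powr r"
    using times_trunc_phi_le[OF M, of r s] r by (simp add: abs_mult[symmetric])
  moreover have "1 * \<bar>trunc_phi r M s\<bar> \<le> \<bar>s\<bar> * \<bar>trunc_phi r M s\<bar>"
    using False by (intro mult_right_mono) auto
  ultimately show ?thesis by linarith
qed

lemma continuous_on_trunc_phi:
  assumes "1 < r" "0 < M"
  shows "continuous_on S (trunc_phi r M)"
proof -
  have "continuous_on S (\<lambda>s. (max 1 (\<bar>s\<bar> / M)) powr r)"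
    using assms by (intro continuous_on_powr' continuous_intros) auto
  moreover have "(max 1 (\<bar>s\<bar> / M)) powr r \<noteq> 0" for s
    using max.cobounded1[of 1 "\<bar>s\<bar> / M"] by (simp only: powr_eq_0_iff)
  ultimately show ?thesis
    unfolding trunc_phi_def[abs_def] by (intro continuous_on_divide continuous_on_phi assms) auto
qed

text \<open>For potentials bounded by \<open>A\<close> the truncation level \<open>M\<close> is never reached by periodic solutions:
  \<open>c\<close> is a value of \<open>a\<close> by Rolle's theorem for \<open>w e\<^bsup>(p-1)v\<^esup>\<close>, and at the extrema of \<open>w\<close>
  the equation bounds \<open>|w|\<close>.\<close>

lemma periodic_Riccati_system:
  fixes a :: "real \<Rightarrow> real \<Rightarrow> real"
  assumes T: "0 < T" and p: "1 < p"
    and a: "continuous_on ({0..T} \<times> UNIV) (\<lambda>(t, v). a t v)"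
    and aA: "\<And>t v. t \<in> {0..T} \<Longrightarrow> \<bar>a t v\<bar> \<le> A"
  obtains D :: real where "0 < D" and
    "\<And>R. 0 < R \<Longrightarrow> \<exists>v w c.
      (\<forall>x\<in>{0..T}. (v has_real_derivative phi (p / (p - 1)) (w x)) (at x within {0..T})) \<and>
      (\<forall>x\<in>{0..T}. (w has_real_derivative a x (v x) - c - (p - 1) * (w x * phi (p / (p - 1)) (w x)))
        (at x within {0..T})) \<and>
      v 0 = v T \<and> w 0 = w T \<and> (\<forall>x\<in>{0..T}. \<bar>v x - v 0\<bar> \<le> D) \<and>
      (c = 0 \<or> v 0 = R \<and> 0 < c \<or> v 0 = - R \<and> c < 0)"
proof -
  let ?q = "p / (p - 1)"
  have q: "1 < ?q" using p by simp
  have A0: "0 \<le> A" using order_trans[OF abs_ge_zero aA[of 0]] T by simp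
  \<comment> \<open>\<open>(p - 1) * M powr p' = 2 * A + 1\<close>, with
    \<open>p' = p / (p - 1)\<close>, exceeds the bound \<open>2 * A\<close> for
    \<open>a - c\<close>; hence \<open>w'\<close> is negative wherever the modulus of
    \<open>w\<close> reaches \<open>M\<close>.\<close>
  define M where "M = ((2 * A + 1) / (p - 1)) powr (1 / ?q)"
  have M: "0 < M" "(p - 1) * M powr ?q = 2 * A + 1"
    using A0 p q by (auto simp: M_def powr_powr)
  define P where "P = trunc_phi ?q M"
  \<comment> \<open>\<open>T\<close> times a bound for the derivative of \<open>v\<close>; it does
    not involve \<open>R\<close>.\<close>
  define D where "D = T * (1 + M powr ?q)"
  have P0: "0 \<le> s * P s" for s by (simp add: P_def times_trunc_phi)
  have D0: "0 < D" using T by (simp add: D_def add_pos_nonneg)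
  show thesis
  proof (rule that[OF D0])
    fix R :: real assume R: "0 < R"
    obtain v w c where v: "\<And>x. x \<in> {0..T} \<Longrightarrow> (v has_real_derivative P (w x)) (at x within {0..T})"
      and w: "\<And>x. x \<in> {0..T} \<Longrightarrow>
        (w has_real_derivative a x (v x) - c - (p - 1) * (w x * P (w x))) (at x within {0..T})"
      and per: "v 0 = v T" "w 0 = w T"
      and c: "c = 0 \<or> v 0 = R \<and> 0 < c \<or> v 0 = - R \<and> c < 0"
    proof (rule clipped_periodic_system[OF T p R a aA, of P "1 + M powr ?q" "M powr ?q"])
      show "continuous_on UNIV P" unfolding P_def by (rule continuous_on_trunc_phi[OF q M(1)])
      show "\<bar>P s\<bar> \<le> 1 + M powr ?q" for s unfolding P_def by (rule abs_trunc_phi_le[OF M(1) q])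
      show "s * P s \<le> M powr ?q" for s unfolding P_def using q by (intro times_trunc_phi_le M) auto
    qed (use P0 in \<open>auto intro: that\<close>)
    have sub: "{0..T} \<subseteq> {0..T}" by simp
    have cA: "\<bar>c\<bar> \<le> A"
    proof -
      have y: "((\<lambda>x. w x * exp ((p - 1) * v x)) has_real_derivative exp ((p - 1) * v x) * (a x (v x) - c))
          (at x within {0..T})" if "x \<in> {0..T}" for x
        by (rule derivative_eq_intros w[OF that] v[OF that] refl)+ (simp add: algebra_simps)
      obtain \<xi> where \<xi>: "\<xi> \<in> {0<..<T}"
        "w T * exp ((p - 1) * v T) - w 0 * exp ((p - 1) * v 0) = (T - 0) * (exp ((p - 1) * v \<xi>) * (a \<xi> (v \<xi>) - c))"
        by (rule mvt_Icc[OF T sub y]) (assumption, rule that)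
      then have "c = a \<xi> (v \<xi>)" using per T by simp
      then show ?thesis using aA \<xi>(1) by simp
    qed
    have small: "\<bar>w s\<bar> < M" if "s \<in> {0..T}" "0 \<le> a s (v s) - c - (p - 1) * (w s * P (w s))" for s
    proof (rule ccontr)
      assume "\<not> \<bar>w s\<bar> < M"
      then have "w s * P (w s) = M powr ?q"
        unfolding P_def by (intro times_trunc_phi_large M) simp
      then show False using that(2) M(2) aA[OF that(1), of "v s"] cA by simp
    qed
    have wM: "\<bar>w x\<bar> \<le> M" if x: "x \<in> {0..T}" for x
    proof -
      obtain s where "s \<in> {0..T}" "\<And>x. x \<in> {0..T} \<Longrightarrow> w x \<le> w s" "0 \<le> a s (v s) - c - (p - 1) * (w s * P (w s))"
        by (rule periodic_max_derivative_nonneg[OF T per(2) w]) (assumption, rule that)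
      then have "w x \<le> M" using small[of s] x by fastforce
      moreover obtain s where "s \<in> {0..T}" "\<And>x. x \<in> {0..T} \<Longrightarrow> w s \<le> w x" "0 \<le> a s (v s) - c - (p - 1) * (w s * P (w s))"
        by (rule periodic_min_derivative_nonneg[OF T per(2) w]) (assumption, rule that)
      then have "- M \<le> w x" using small[of s] x by fastforce
      ultimately show ?thesis by simp
    qed
    then have Pw: "P (w x) = phi ?q (w x)" if "x \<in> {0..T}" for x
      using that unfolding P_def by (intro trunc_phi_eq M) auto
    have vD: "\<bar>v x - v 0\<bar> \<le> D" if x: "x \<in> {0..T}" for x
    proof (cases "x = 0")
      case False
      with x have "0 < x" "{0..x} \<subseteq> {0..T}" by auto
      then obtain \<xi> where \<xi>: "\<xi> \<in> {0<..<x}" "v x - v 0 = (x - 0) * P (w \<xi>)"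
        by (rule mvt_Icc[OF _ _ v]) (assumption, rule that)
      have "\<bar>v x - v 0\<bar> = x * \<bar>P (w \<xi>)\<bar>" using \<xi>(2) \<open>0 < x\<close> by (simp add: abs_mult)
      also have "\<dots> \<le> D"
        unfolding D_def P_def using x abs_trunc_phi_le[OF M(1) q] by (intro mult_mono) auto
      finally show ?thesis .
    qed (use D0 in simp)
    show "\<exists>v w c.
      (\<forall>x\<in>{0..T}. (v has_real_derivative phi ?q (w x)) (at x within {0..T})) \<and>
      (\<forall>x\<in>{0..T}. (w has_real_derivative a x (v x) - c - (p - 1) * (w x * phi ?q (w x)))
        (at x within {0..T})) \<and>
      v 0 = v T \<and> w 0 = w T \<and> (\<forall>x\<in>{0..T}. \<bar>v x - v 0\<bar> \<le> D) \<and>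
      (c = 0 \<or> v 0 = R \<and> 0 < c \<or> v 0 = - R \<and> c < 0)"
      using v w per vD c Pw by (intro exI[of _ v] exI[of _ w] exI[of _ c]) simp
  qed
qed

section \<open>Periodic solutions of one sign\<close>

lemma bounded_on_Icc:
  fixes f :: "real \<Rightarrow> real"
  assumes "continuous_on {a..b} f"
  obtains B where "0 < B" "\<And>x. x \<in> {a..b} \<Longrightarrow> \<bar>f x\<bar> \<le> B"
proof -
  have "bounded (f ` {a..b})" by (intro compact_imp_bounded compact_continuous_image assms) auto
  then obtain B where "0 < B" "\<forall>y\<in>f ` {a..b}. norm y \<le> B" unfolding bounded_pos by blast
  then show thesis using that by auto
qed

lemma bounded_if_limits_at_ends:
  fixes k :: "real \<Rightarrow> real"
  assumes k: "continuous_on UNIV k" and bot: "(k \<longlongrightarrow> k0) at_bot" and top: "(k \<longlongrightarrow> k1) at_top"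
  obtains B where "\<And>x. \<bar>k x\<bar> \<le> B"
proof -
  have "\<forall>\<^sub>F x in at_bot. dist (k x) k0 < 1" "\<forall>\<^sub>F x in at_top. dist (k x) k1 < 1"
    using tendstoD[OF bot, of 1] tendstoD[OF top, of 1] by auto
  then obtain b c where b: "\<And>x. x \<le> b \<Longrightarrow> dist (k x) k0 < 1" and c: "\<And>x. c \<le> x \<Longrightarrow> dist (k x) k1 < 1"
    unfolding eventually_at_bot_linorder eventually_at_top_linorder by blast
  obtain B where B: "\<And>x. x \<in> {b..c} \<Longrightarrow> \<bar>k x\<bar> \<le> B"
    by (rule bounded_on_Icc[OF continuous_on_subset[OF k subset_UNIV]]) (rule that)
  have "\<bar>k x\<bar> \<le> \<bar>B\<bar> + \<bar>k0\<bar> + \<bar>k1\<bar> + 1" for x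
    using b[of x] c[of x] B[of x] by (cases "x \<le> b"; cases "c \<le> x") (auto simp: dist_real_def)
  then show thesis by (rule that)
qed

text \<open>For large \<open>R\<close> a nonzero \<open>c\<close> is impossible: at
  \<open>v 0 = - R\<close> the positive integral of \<open>q\<close> dominates, and at
  \<open>v 0 = R\<close> Picone's inequality contradicts \<open>neg\<close>.\<close>

lemma log_system_solution:
  fixes T p l K :: real and q m k :: "real \<Rightarrow> real"
  assumes T: "0 < T" and p: "1 < p"
    and q: "continuous_on {0..T} q" "\<And>x. x \<in> {0..T} \<Longrightarrow> 0 \<le> q x" "\<exists>x\<in>{0..T}. q x \<noteq> 0"
    and m: "continuous_on {0..T} m"
    and k: "continuous_on UNIV k" "(k \<longlongrightarrow> 0) at_bot" "(k \<longlongrightarrow> K) at_top"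
    and W: "(U, U') \<in> W1p_per T p"
    and neg: "(LINT x:{0<..<T}|lebesgue. \<bar>U' x\<bar> powr p + (q x - l * m x * K) * \<bar>U x\<bar> powr p) < 0"
  obtains v w where
    "\<And>x. x \<in> {0..T} \<Longrightarrow> (v has_real_derivative phi (p / (p - 1)) (w x)) (at x within {0..T})"
    "\<And>x. x \<in> {0..T} \<Longrightarrow>
      (w has_real_derivative q x - l * m x * k (v x) - (p - 1) * (w x * phi (p / (p - 1)) (w x))) (at x within {0..T})"
    "v 0 = v T" "w 0 = w T"
proof -
  let ?q = "p / (p - 1)"
  obtain Bk where Bk: "\<And>x. \<bar>k x\<bar> \<le> Bk" by (rule bounded_if_limits_at_ends[OF k]) (rule that)
  obtain Bm where Bm: "0 < Bm" "\<And>x. x \<in> {0..T} \<Longrightarrow> \<bar>l * m x\<bar> \<le> Bm"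
    by (rule bounded_on_Icc[of 0 T "\<lambda>x. l * m x"]) (auto intro: continuous_intros m that)
  obtain Bq where Bq: "0 < Bq" "\<And>x. x \<in> {0..T} \<Longrightarrow> \<bar>q x\<bar> \<le> Bq"
    by (rule bounded_on_Icc[OF q(1)]) (rule that)
  define a where "a t v = q t - l * m t * k v" for t v
  have a: "continuous_on ({0..T} \<times> UNIV) (\<lambda>(t, v). a t v)"
    unfolding a_def case_prod_unfold
    by (intro continuous_intros continuous_on_compose2[OF q(1)] continuous_on_compose2[OF m]
        continuous_on_compose2[OF k(1)]) auto
  have lmk: "\<bar>l * m t * y\<bar> \<le> Bm * e" if "t \<in> {0..T}" "\<bar>y\<bar> \<le> e" for t y e
    using mult_mono[OF Bm(2)[OF that(1)] that(2)] Bm(1) by (simp add: abs_mult)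
  have aA: "\<bar>a t v\<bar> \<le> Bq + Bm * Bk" if "t \<in> {0..T}" for t v
    using lmk[OF that Bk[of v]] Bq(2)[OF that] unfolding a_def by linarith
  obtain D where D: "0 < D" and sol:
    "\<And>R. 0 < R \<Longrightarrow> \<exists>v w c.
      (\<forall>x\<in>{0..T}. (v has_real_derivative phi ?q (w x)) (at x within {0..T})) \<and>
      (\<forall>x\<in>{0..T}. (w has_real_derivative a x (v x) - c - (p - 1) * (w x * phi ?q (w x)))
        (at x within {0..T})) \<and>
      v 0 = v T \<and> w 0 = w T \<and> (\<forall>x\<in>{0..T}. \<bar>v x - v 0\<bar> \<le> D) \<and>
      (c = 0 \<or> v 0 = R \<and> 0 < c \<or> v 0 = - R \<and> c < 0)"
    by (rule periodic_Riccati_system[OF T p a aA]) (assumption, rule that)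
  define J where "J = integral {0..T} q"
  have "J \<noteq> 0"
    using integral_eq_0_iff[OF q(1) T q(2)] q(3) by (auto simp: J_def)
  moreover have "0 \<le> J" unfolding J_def by (intro integral_nonneg integrable_continuous_real q)
  ultimately have J: "0 < J" by simp
  define N where "N = (LINT x:{0<..<T}|lebesgue. \<bar>U x\<bar> powr p)"
  define E where "E = (LINT x:{0<..<T}|lebesgue. \<bar>U' x\<bar> powr p + (q x - l * m x * K) * \<bar>U x\<bar> powr p)"
  have E0: "E < 0" using neg by (simp only: E_def)
  have N0: "0 \<le> N" unfolding N_def set_lebesgue_integral_def by (intro integral_nonneg_AE AE_I2) simp
  have U: "continuous_on {0..T} U" using W by (simp add: W1p_per_def)
  have Up: "continuous_on {0..T} (\<lambda>x. \<bar>U x\<bar> powr p)"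
    using p by (intro continuous_on_powr' continuous_intros U) auto
  \<comment> \<open>Makes the contribution of \<open>k\<close> at most half of that of
    \<open>q\<close>, although the weight \<open>exp (p * v x)\<close> varies between
    \<open>exp (p * (v 0 - D))\<close> and \<open>exp (p * (v 0 + D))\<close>.\<close>
  define e0 where "e0 = exp (- (2 * p * D)) * J / (2 * T * Bm)"
  \<comment> \<open>Makes the perturbation \<open>Bm * e1 * N\<close> at most
    \<open>- E / 2\<close>; \<open>N + 1\<close> avoids division by 0.\<close>
  define e1 where "e1 = - E / (2 * (N + 1)) / Bm"
  have e0: "0 < e0" using J T Bm by (simp add: e0_def)
  have e1: "0 < e1" using E0 N0 Bm by (simp add: e1_def divide_neg_pos)
  have "\<forall>\<^sub>F x in at_bot. dist (k x) 0 < e0" "\<forall>\<^sub>F x in at_top. dist (k x) K < e1"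
    using tendstoD[OF k(2) e0] tendstoD[OF k(3) e1] by auto
  then obtain y0 y1 where y0: "\<And>x. x \<le> y0 \<Longrightarrow> \<bar>k x\<bar> < e0" and y1: "\<And>x. y1 \<le> x \<Longrightarrow> \<bar>k x - K\<bar> < e1"
    unfolding eventually_at_bot_linorder eventually_at_top_linorder dist_real_def by auto
  \<comment> \<open>Since \<open>v\<close> stays within \<open>D\<close> of \<open>v 0\<close>, the
    values of \<open>v\<close> lie below \<open>y0\<close> if \<open>v 0 = - R\<close>, and above
    \<open>y1\<close> if \<open>v 0 = R\<close>.\<close>
  define R where "R = max 1 (max (D - y0) (D + y1))"
  have R: "0 < R" "- R + D \<le> y0" "y1 \<le> R - D" by (auto simp: R_def)
  from sol[OF R(1)] obtain v w c where
    v: "\<And>x. x \<in> {0..T} \<Longrightarrow> (v has_real_derivative phi ?q (w x)) (at x within {0..T})"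
    and w: "\<And>x. x \<in> {0..T} \<Longrightarrow>
      (w has_real_derivative a x (v x) - c - (p - 1) * (w x * phi ?q (w x))) (at x within {0..T})"
    and per: "v 0 = v T" "w 0 = w T" and vD: "\<And>x. x \<in> {0..T} \<Longrightarrow> \<bar>v x - v 0\<bar> \<le> D"
    and c: "c = 0 \<or> v 0 = R \<and> 0 < c \<or> v 0 = - R \<and> c < 0"
    by metis
  have cv: "continuous_on {0..T} v" using v by (rule DERIV_continuous_on)
  have "\<not> (v 0 = - R \<and> c < 0)"
  proof
    assume low: "v 0 = - R \<and> c < 0"
    define Y' where "Y' x = exp (p * v x) * (a x (v x) - c + w x * phi ?q (w x))" for x
    have Y: "((\<lambda>x. w x * exp (p * v x)) has_real_derivative Y' x) (at x within {0..T})" if "x \<in> {0..T}" for x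
      unfolding Y'_def by (rule derivative_eq_intros w[OF that] v[OF that] refl)+ (simp add: algebra_simps)
    have "(Y' has_integral w T * exp (p * v T) - w 0 * exp (p * v 0)) {0..T}"
      using T Y by (intro fundamental_theorem_of_calculus) (auto simp: has_real_derivative_iff_has_vector_derivative)
    then have Y0: "(Y' has_integral 0) {0..T}" using per by simp
    let ?z = "\<lambda>x. exp (p * (v 0 - D)) * q x - exp (p * (v 0 + D)) * (Bm * e0)"
    have "(q has_integral J) {0..T}"
      unfolding J_def by (intro integrable_integral integrable_continuous_real q)
    from has_integral_diff[OF has_integral_mult_right[OF this] has_integral_const_real]
    have "(?z has_integral exp (p * (v 0 - D)) * J - (T - 0) *\<^sub>R (exp (p * (v 0 + D)) * (Bm * e0))) {0..T}"
      using T by simp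
    moreover have "?z x \<le> Y' x" if x: "x \<in> {0..T}" for x
    proof -
      have "v x \<le> y0" using vD[OF x] low R(2) by (auto simp: abs_le_iff)
      then have "\<bar>k (v x)\<bar> \<le> e0" using y0[of "v x"] by simp
      from lmk[OF x this] have *: "q x - Bm * e0 \<le> a x (v x) - c + w x * phi ?q (w x)"
        using low by (simp add: a_def times_phi abs_le_iff add_increasing2)
      have "exp (p * (v 0 - D)) * q x \<le> exp (p * v x) * q x"
        using vD[OF x] p q(2)[OF x] by (intro mult_right_mono) (auto simp: abs_le_iff)
      moreover have "exp (p * v x) * (Bm * e0) \<le> exp (p * (v 0 + D)) * (Bm * e0)"
        using vD[OF x] p Bm e0 by (intro mult_right_mono) (auto simp: abs_le_iff)
      moreover have "exp (p * v x) * (q x - Bm * e0) \<le> Y' x"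
        unfolding Y'_def using * by (intro mult_left_mono) auto
      ultimately show ?thesis by (simp add: algebra_simps)
    qed
    ultimately have "exp (p * (v 0 - D)) * J - T * (exp (p * (v 0 + D)) * (Bm * e0)) \<le> 0"
      using has_integral_le[OF _ Y0] by fastforce
    moreover have "T * (exp (p * (v 0 + D)) * (Bm * e0)) = exp (p * (v 0 - D)) * J / 2"
    proof -
      have "exp (p * (v 0 + D)) * exp (- (2 * p * D)) = exp (p * (v 0 - D))"
        by (simp add: exp_add[symmetric] algebra_simps)
      moreover have "T * (exp (p * (v 0 + D)) * (Bm * e0)) = exp (p * (v 0 + D)) * exp (- (2 * p * D)) * J / 2"
        using T Bm(1) by (simp add: e0_def)
      ultimately show ?thesis by simp
    qed
    ultimately show False using mult_pos_pos[OF exp_gt_zero J, of "p * (v 0 - D)"] by linarith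
  qed
  moreover have "\<not> (v 0 = R \<and> 0 < c)"
  proof
    assume high: "v 0 = R \<and> 0 < c"
    have cd: "continuous_on {0..T} (\<lambda>x. a x (v x) - c)"
      unfolding a_def
      by (intro continuous_intros q m continuous_on_compose2[OF k(1) cv]) auto
    \<comment> \<open>Here \<open>c > 0\<close> helps: dropping it only enlarges the potential
      \<open>a - c\<close>, which is therefore at most the limiting potential plus
      \<open>Bm * e1\<close>.\<close>
    have "0 \<le> (LINT x:{0<..<T}|lebesgue. \<bar>U' x\<bar> powr p + (a x (v x) - c) * \<bar>U x\<bar> powr p)"
      by (rule Picone_W1p_per[OF T p W cd w per(2)])
    also have "\<dots> \<le> (LINT x:{0<..<T}|lebesgue. (\<bar>U' x\<bar> powr p + (q x - l * m x * K) * \<bar>U x\<bar> powr p)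
        + Bm * e1 * \<bar>U x\<bar> powr p)"
    proof (rule set_integral_mono)
      show "set_integrable lebesgue {0<..<T} (\<lambda>x. \<bar>U' x\<bar> powr p + (a x (v x) - c) * \<bar>U x\<bar> powr p)"
        unfolding set_integrable_Ioo_iff_Icc
        by (intro set_integral_add W1p_per_integrable(1)[OF W p] set_integrable_continuous continuous_on_mult cd Up)
      show "set_integrable lebesgue {0<..<T} (\<lambda>x. (\<bar>U' x\<bar> powr p + (q x - l * m x * K) * \<bar>U x\<bar> powr p)
        + Bm * e1 * \<bar>U x\<bar> powr p)"
        unfolding set_integrable_Ioo_iff_Icc
        by (intro set_integral_add W1p_per_integrable(1)[OF W p] set_integrable_continuous continuous_intros q m Up)
      fix x assume "x \<in> {0<..<T}"
      then have x: "x \<in> {0..T}" by simp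
      have "y1 \<le> v x" using vD[OF x] high R(3) by (auto simp: abs_le_iff)
      then have "\<bar>k (v x) - K\<bar> \<le> e1" using y1[of "v x"] by simp
      from lmk[OF x this] have "a x (v x) - c \<le> q x - l * m x * K + Bm * e1"
        using high by (simp add: a_def abs_le_iff right_diff_distrib)
      then have "(a x (v x) - c) * \<bar>U x\<bar> powr p \<le> (q x - l * m x * K + Bm * e1) * \<bar>U x\<bar> powr p"
        by (rule mult_right_mono) simp
      then show "\<bar>U' x\<bar> powr p + (a x (v x) - c) * \<bar>U x\<bar> powr p \<le>
          (\<bar>U' x\<bar> powr p + (q x - l * m x * K) * \<bar>U x\<bar> powr p) + Bm * e1 * \<bar>U x\<bar> powr p"
        by (simp add: distrib_right)
    qed
    also have "\<dots> = E + Bm * e1 * N"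
      unfolding E_def N_def set_integral_mult_right[symmetric]
      by (intro set_integral_add(2); unfold set_integrable_Ioo_iff_Icc;
          intro set_integral_add W1p_per_integrable(1)[OF W p] set_integrable_continuous continuous_intros q m Up)
    also have "\<dots> < 0"
    proof -
      have "Bm * e1 * N = (- E) * (N / (2 * (N + 1)))" using Bm(1) by (simp add: e1_def)
      also have "\<dots> \<le> (- E) * (1 / 2)"
        using E0 N0 by (intro mult_left_mono) (auto simp: field_simps)
      finally show ?thesis using E0 by simp
    qed
    finally show False by simp
  qed
  ultimately have "c = 0" using c by blast
  show thesis
    by (rule that[OF v _ per]) (use w in \<open>simp_all add: a_def \<open>c = 0\<close>\<close>)
qed

section \<open>Admissible functions of negative energy\<close>

lemma C1_in_W1p_per:
  assumes T: "0 < T" and p: "1 < p"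
    and U: "\<And>x. (U has_real_derivative U' x) (at x)" and U': "continuous_on UNIV U'" and per: "U 0 = U T"
  shows "(U, U') \<in> W1p_per T p"
proof -
  have cU: "continuous_on S U" for S
    using U by (meson DERIV_isCont continuous_at_imp_continuous_on)
  have cU': "continuous_on S U'" for S
    using U' by (rule continuous_on_subset) simp
  have Lp: "Lp_on p {0<..<T} g" if g: "continuous_on {0..T} g" for g
  proof -
    have "set_integrable lebesgue {0<..<T} g"
      unfolding set_integrable_Ioo_iff_Icc by (rule set_integrable_continuous[OF g])
    then have "set_borel_measurable lebesgue {0<..<T} g"
      unfolding set_integrable_def set_borel_measurable_def by (rule borel_measurable_integrable)
    moreover have "set_integrable lebesgue {0<..<T} (\<lambda>x. \<bar>g x\<bar> powr p)"
      unfolding set_integrable_Ioo_iff_Icc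
      using p by (intro set_integrable_continuous continuous_on_powr' continuous_intros g) auto
    ultimately show ?thesis by (simp add: Lp_on_def)
  qed
  have "weak_deriv_on {0<..<T} U U'"
    unfolding weak_deriv_on_def
  proof
    fix h assume "h \<in> C1c {0<..<T}"
    then obtain D K where D: "\<And>x. (h has_real_derivative D x) (at x)" "continuous_on UNIV D"
      and K: "K \<subseteq> {0<..<T}" "\<And>x. x \<notin> K \<Longrightarrow> h x = 0"
      unfolding C1c_def C1_differentiable_on_def has_real_derivative_iff_has_vector_derivative by auto
    have cD: "continuous_on S D" for S
      using D(2) by (rule continuous_on_subset) simp
    have ch: "continuous_on S h" for S
      using D(1) by (meson DERIV_isCont continuous_at_imp_continuous_on)
    have "deriv h = D" using D(1) by (auto intro: DERIV_imp_deriv)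
    have "0 \<notin> K" "T \<notin> K" using K(1) by auto
    then have h0: "h 0 = 0" "h T = 0" using K(2) by auto
    have "((\<lambda>x. U x * D x + U' x * h x) has_integral U T * h T - U 0 * h 0) {0..T}"
    proof (rule fundamental_theorem_of_calculus)
      fix x
      have "((\<lambda>x. U x * h x) has_real_derivative U x * D x + U' x * h x) (at x within {0..T})"
        using DERIV_mult'[OF DERIV_subset[OF U subset_UNIV] DERIV_subset[OF D(1) subset_UNIV]] .
      then show "((\<lambda>x. U x * h x) has_vector_derivative U x * D x + U' x * h x) (at x within {0..T})"
        by (simp add: has_real_derivative_iff_has_vector_derivative)
    qed (use T in simp)
    then have "integral {0..T} (\<lambda>x. U x * D x + U' x * h x) = 0"
      using h0 by (simp add: integral_unique)
    then have "integral {0..T} (\<lambda>x. U x * D x) + integral {0..T} (\<lambda>x. U' x * h x) = 0"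
      by (subst (asm) Henstock_Kurzweil_Integration.integral_add)
        (auto intro!: integrable_continuous_real continuous_on_mult cU cU' cD ch)
    moreover have "(LINT x:{0<..<T}|lebesgue. U x * D x) = integral {0..T} (\<lambda>x. U x * D x)"
      "(LINT x:{0<..<T}|lebesgue. U' x * h x) = integral {0..T} (\<lambda>x. U' x * h x)"
      by (intro set_lebesgue_integral_Ioo set_integrable_continuous continuous_on_mult cU cU' cD ch)+
    ultimately show "(LINT x:{0<..<T}|lebesgue. U x * deriv h x) = - (LINT x:{0<..<T}|lebesgue. U' x * h x)"
      using \<open>deriv h = D\<close> by simp
  qed
  with Lp[OF cU] Lp[OF cU'] cU per show ?thesis by (simp add: W1p_per_def)
qed

text \<open>A \<open>C1\<close> bump supported where \<open>m\<close> is positive, rescaled. It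
  shows that the sets defining the two eigenvalues are nonempty, without which their
  \<open>Inf\<close> and \<open>Sup\<close> would say nothing; for the negative one it is applied to
  \<open>- m\<close>.\<close>

lemma W1p_per_normalized_exists:
  assumes T: "0 < T" and p: "1 < p" and m: "continuous_on {0..T} m"
    and pos: "x0 \<in> {0..T}" "0 < m x0"
  shows "\<exists>U U'. (U, U') \<in> W1p_per T p \<and> (LINT x:{0<..<T}|lebesgue. m x * \<bar>U x\<bar> powr p) = 1"
proof -
  obtain d where d: "0 < d" "\<And>x. x \<in> {0..T} \<Longrightarrow> \<bar>x - x0\<bar> < d \<Longrightarrow> \<bar>m x - m x0\<bar> < m x0"
    using m pos unfolding continuous_on_iff dist_real_def by metis
  define b1 where "b1 = max 0 (x0 - d)"
  define b2 where "b2 = min T (x0 + d)"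
  have b: "b1 < b2" "0 \<le> b1" "b2 \<le> T" "x0 - d \<le> b1" "b2 \<le> x0 + d"
    using d(1) pos T by (auto simp: b1_def b2_def)
  \<comment> \<open>The middle third keeps the support away from 0 and \<open>T\<close> even if
    \<open>x0\<close> is an endpoint, so the bump is periodic.\<close>
  define a where "a = b1 + (b2 - b1) / 3"
  define c where "c = b2 - (b2 - b1) / 3"
  have ac: "0 < a" "a < c" "c < T" "x0 - d < a" "c < x0 + d"
    using b by (auto simp: a_def c_def field_simps)
  have mpos: "0 < m x" if "x \<in> {a..c}" for x
    using d(2)[of x] that ac by (auto simp: abs_less_iff)
  define V where "V x = (max 0 (x - a))\<^sup>2 * (max 0 (c - x))\<^sup>2" for x
  define V' where "V' x = (max 0 (x - a))\<^sup>2 * (2 * max 0 (c - x) * (0 - 1)) + (2 * max 0 (x - a) * (1 - 0)) * (max 0 (c - x))\<^sup>2" for x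
  have V: "(V has_real_derivative V' x) (at x)" for x
    unfolding V_def[abs_def] V'_def
    by (intro DERIV_mult' DERIV_max_0_square_chain DERIV_diff DERIV_ident DERIV_const)
  have cV': "continuous_on UNIV V'" unfolding V'_def by (intro continuous_intros)
  have cV: "continuous_on {0..T} V" unfolding V_def by (intro continuous_intros)
  have V0: "V x = 0" if "x \<notin> {a..c}" for x using that by (auto simp: V_def max_def)
  define I where "I = integral {0..T} (\<lambda>x. m x * \<bar>V x\<bar> powr p)"
  have cI: "continuous_on {0..T} (\<lambda>x. m x * \<bar>V x\<bar> powr p)"
    using p by (intro continuous_on_mult m continuous_on_powr' continuous_intros cV) auto
  have nn: "0 \<le> m x * \<bar>V x\<bar> powr p" for x
    using mpos[of x] V0[of x] by (cases "x \<in> {a..c}") (auto intro: mult_nonneg_nonneg less_imp_le)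
  have "I \<noteq> 0"
  proof
    assume "I = 0"
    then have "\<forall>x\<in>{0..T}. m x * \<bar>V x\<bar> powr p = 0"
      using integral_eq_0_iff[OF cI T nn] by (simp add: I_def)
    moreover define y where "y = (a + c) / 2"
    have y: "y \<in> {0..T}" "y \<in> {a..c}" "a < y" "y < c" using ac by (auto simp: y_def)
    ultimately have "m y * \<bar>V y\<bar> powr p = 0" by blast
    then show False using mpos[OF y(2)] y(3,4) by (simp add: V_def)
  qed
  moreover have "0 \<le> I" unfolding I_def by (intro integral_nonneg integrable_continuous_real cI nn)
  ultimately have I: "0 < I" by simp
  define \<kappa> where "\<kappa> = (1 / I) powr (1 / p)"
  have \<kappa>: "\<kappa> powr p = 1 / I" unfolding \<kappa>_def powr_powr using I p by simp
  have "(\<lambda>x. \<kappa> * V x, \<lambda>x. \<kappa> * V' x) \<in> W1p_per T p"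
  proof (rule C1_in_W1p_per[OF T p])
    show "((\<lambda>x. \<kappa> * V x) has_real_derivative \<kappa> * V' x) (at x)" for x by (rule DERIV_cmult[OF V])
    show "continuous_on UNIV (\<lambda>x. \<kappa> * V' x)" by (intro continuous_intros cV')
    show "\<kappa> * V 0 = \<kappa> * V T" using V0[of 0] V0[of T] ac by simp
  qed
  moreover have "(LINT x:{0<..<T}|lebesgue. m x * \<bar>\<kappa> * V x\<bar> powr p) = 1"
  proof -
    have "m x * \<bar>\<kappa> * V x\<bar> powr p = (1 / I) * (m x * \<bar>V x\<bar> powr p)" for x
      using \<kappa> by (simp add: abs_mult powr_mult) (simp add: \<kappa>_def)
    then have "(LINT x:{0<..<T}|lebesgue. m x * \<bar>\<kappa> * V x\<bar> powr p)
        = (1 / I) * (LINT x:{0<..<T}|lebesgue. m x * \<bar>V x\<bar> powr p)"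
      by (simp only: set_integral_mult_right)
    also have "\<dots> = 1"
      using set_lebesgue_integral_Ioo[OF set_integrable_continuous[OF cI]] I by (simp add: I_def)
    finally show ?thesis .
  qed
  ultimately show ?thesis by blast
qed

text \<open>If \<open>l * K\<close> lies beyond \<open>lambda0_plus\<close>, some admissible
  \<open>U\<close> has energy below \<open>l * K\<close>; as its weighted mass is 1, the shifted
  energy \<open>E - l * K * N\<close> is negative. For \<open>lambda0_minus\<close> the mass is -1
  and the signs reverse.\<close>

lemma negative_energy:
  assumes T: "0 < T" and p: "1 < p" and q: "continuous_on {0..T} q" and m: "continuous_on {0..T} m"
    and mpos: "\<exists>x\<in>{0..T}. m x > 0" and mneg: "\<exists>x\<in>{0..T}. m x < 0" and K: "0 < K"
    and l: "l \<in> {lambda0_plus T p q m / K <..} \<union> {..< lambda0_minus T p q m / K}"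
  obtains U U' where "(U, U') \<in> W1p_per T p"
    "(LINT x:{0<..<T}|lebesgue. \<bar>U' x\<bar> powr p + (q x - l * m x * K) * \<bar>U x\<bar> powr p) < 0"
proof -
  define E where "E U U' = (LINT x:{0<..<T}|lebesgue. \<bar>U' x\<bar> powr p + q x * \<bar>U x\<bar> powr p)" for U U'
  define N where "N U = (LINT x:{0<..<T}|lebesgue. m x * \<bar>U x\<bar> powr p)" for U
  have split: "(LINT x:{0<..<T}|lebesgue. \<bar>U' x\<bar> powr p + (q x - l * m x * K) * \<bar>U x\<bar> powr p)
      = E U U' - l * K * N U" if W: "(U, U') \<in> W1p_per T p" for U U'
  proof -
    have U: "continuous_on {0..T} U" using W by (simp add: W1p_per_def)
    have Up: "continuous_on {0..T} (\<lambda>x. \<bar>U x\<bar> powr p)"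
      using p by (intro continuous_on_powr' continuous_intros U) auto
    have "E U U' - l * K * N U = (LINT x:{0<..<T}|lebesgue. (\<bar>U' x\<bar> powr p + q x * \<bar>U x\<bar> powr p) - l * K * (m x * \<bar>U x\<bar> powr p))"
      unfolding E_def N_def set_integral_mult_right[symmetric]
      by (intro set_integral_diff(2)[symmetric]; unfold set_integrable_Ioo_iff_Icc;
          intro set_integral_add W1p_per_integrable(1)[OF W p] set_integrable_continuous continuous_intros q m Up)
    then show ?thesis by (simp add: algebra_simps)
  qed
  consider "lambda0_plus T p q m / K < l" | "l < lambda0_minus T p q m / K" using l by auto
  then show thesis
  proof cases
    case 1
    then have *: "lambda0_plus T p q m < l * K" using K by (simp add: pos_divide_less_eq)
    let ?S = "{E U U' | U U'. (U, U') \<in> W1p_per T p \<and> N U = 1}"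
    have "?S \<noteq> {}" using W1p_per_normalized_exists[OF T p m] mpos by (fastforce simp: N_def)
    moreover have "Inf ?S < l * K" using * by (simp add: lambda0_plus_def E_def N_def)
    ultimately obtain z where "z \<in> ?S" "z < l * K" by (rule cInf_lessD[THEN bexE])
    then obtain U U' where "(U, U') \<in> W1p_per T p" "N U = 1" "E U U' < l * K" by blast
    then show thesis using split that by fastforce
  next
    case 2
    then have *: "l * K < lambda0_minus T p q m" using K by (simp add: pos_less_divide_eq)
    let ?S = "{- E U U' | U U'. (U, U') \<in> W1p_per T p \<and> (LINT x:{0<..<T}|lebesgue. - m x * \<bar>U x\<bar> powr p) = 1}"
    have "?S \<noteq> {}"
      using W1p_per_normalized_exists[OF T p continuous_on_minus[OF m]] mneg by fastforce
    moreover have "l * K < Sup ?S" using * by (simp add: lambda0_minus_def E_def)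
    ultimately obtain z where "z \<in> ?S" "l * K < z" by (rule less_cSupD[THEN bexE])
    then obtain U U' where W: "(U, U') \<in> W1p_per T p"
      and n: "(LINT x:{0<..<T}|lebesgue. - m x * \<bar>U x\<bar> powr p) = 1" and "l * K < - E U U'" by blast
    have "N U = - 1"
      using n set_integral_mult_right[of lebesgue "{0<..<T}" "- 1" "\<lambda>x. m x * \<bar>U x\<bar> powr p"] by (simp add: N_def)
    then show thesis using split[OF W] that[OF W] \<open>l * K < - E U U'\<close> by simp
  qed
qed

text \<open>The substitution \<open>u = \<sigma> * exp v\<close> treats both signs at once. The ends
  of the \<open>v\<close>-axis correspond to \<open>u\<close> tending to 0 and to infinity, so the
  quotient \<open>k\<close> has limits 0 and \<open>f_inf\<close> there.\<close>

lemma signed_periodic_solution: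
  fixes T p f_inf l \<sigma> :: real and q m f :: "real \<Rightarrow> real"
  assumes T: "0 < T" and p: "1 < p"
    and q: "continuous_on {0..T} q" "\<And>x. x \<in> {0..T} \<Longrightarrow> 0 \<le> q x" "\<exists>x\<in>{0..T}. q x \<noteq> 0"
    and m: "continuous_on {0..T} m"
    and f: "continuous_on UNIV f" "((\<lambda>s. f s / phi p s) \<longlongrightarrow> 0) (at 0)"
      "((\<lambda>s. f s / phi p s) \<longlongrightarrow> f_inf) at_infinity"
    and W: "(U, U') \<in> W1p_per T p"
    and neg: "(LINT x:{0<..<T}|lebesgue. \<bar>U' x\<bar> powr p + (q x - l * m x * f_inf) * \<bar>U x\<bar> powr p) < 0"
    and \<sigma>: "\<bar>\<sigma>\<bar> = 1"
  obtains u where "periodic_solution T p q m f l u" "\<And>x. x \<in> {0..T} \<Longrightarrow> 0 < \<sigma> * u x"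
proof -
  let ?q = "p / (p - 1)"
  have \<sigma>2: "\<sigma> * \<sigma> = 1" "\<sigma> \<noteq> 0" "phi p \<sigma> = \<sigma>" using \<sigma> by (auto simp: phi_def abs_mult_self_eq abs_if split: if_splits)
  have phi_e: "phi p (\<sigma> * exp x) = \<sigma> * exp ((p - 1) * x)" for x
    using \<sigma>2 by (simp add: phi_mult phi_exp)
  define k where "k x = f (\<sigma> * exp x) / phi p (\<sigma> * exp x)" for x
  have k: "continuous_on UNIV k"
    unfolding k_def phi_e
    by (intro continuous_on_divide continuous_on_compose2[OF f(1)] continuous_intros) (use \<sigma>2 in auto)
  have "((\<lambda>x. \<sigma> * exp x) \<longlongrightarrow> 0) at_bot"
    using tendsto_mult_right_zero[OF exp_at_bot, of \<sigma>] .
  then have "filterlim (\<lambda>x. \<sigma> * exp x) (at 0) at_bot"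
    using \<sigma>2 by (intro filterlim_atI) auto
  from filterlim_compose[OF f(2) this] have k0: "(k \<longlongrightarrow> 0) at_bot"
    by (simp add: k_def[abs_def])
  have "filterlim (\<lambda>x. \<sigma> * exp x) at_infinity at_top"
    using exp_at_top \<sigma> by (intro filterlim_norm_at_top_imp_at_infinity) (simp add: abs_mult)
  from filterlim_compose[OF f(3) this] have k1: "(k \<longlongrightarrow> f_inf) at_top"
    by (simp add: k_def[abs_def])
  obtain v w where
    v: "\<And>x. x \<in> {0..T} \<Longrightarrow> (v has_real_derivative phi ?q (w x)) (at x within {0..T})" and
    w: "\<And>x. x \<in> {0..T} \<Longrightarrow>
      (w has_real_derivative q x - l * m x * k (v x) - (p - 1) * (w x * phi ?q (w x))) (at x within {0..T})" and
    per: "v 0 = v T" "w 0 = w T"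
    by (rule log_system_solution[OF T p q m k k0 k1 W neg]) (assumption, rule that)
  have cv: "continuous_on {0..T} v" using v by (rule DERIV_continuous_on)
  have cw: "continuous_on {0..T} w" using w by (rule DERIV_continuous_on)
  define u where "u x = \<sigma> * exp (v x)" for x
  define u' where "u' x = \<sigma> * exp (v x) * phi ?q (w x)" for x
  define y where "y x = \<sigma> * exp ((p - 1) * v x) * (q x - l * m x * k (v x))" for x
  \<comment> \<open>This product can be differentiated even where \<open>u'\<close> vanishes and
    \<open>phi p\<close> itself may fail to be differentiable; the terms with
    \<open>w * phi p' w\<close>, where \<open>p' = p / (p - 1)\<close>, then cancel, which leaves
    \<open>y\<close>.\<close>
  have phi_u': "phi p (u' x) = \<sigma> * (exp ((p - 1) * v x) * w x)" for x
    unfolding u'_def phi_mult[of p "\<sigma> * exp (v x)"] phi_e phi_conjugate[OF p] by simp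
  have "periodic_solution T p q m f l u"
    unfolding periodic_solution_def
  proof (rule exI[of _ u'], rule exI[of _ y], intro conjI ballI)
    fix x assume x: "x \<in> {0..T}"
    show "(u has_real_derivative u' x) (at x within {0..T})"
      unfolding u_def[abs_def] u'_def
      by (rule derivative_eq_intros v[OF x] refl)+ simp
  next
    show "continuous_on {0..T} u'"
      unfolding u'_def using p
      by (intro continuous_intros cv continuous_on_compose2[OF continuous_on_phi cw]) auto
  next
    fix x assume x: "x \<in> {0<..<T}"
    then have x': "x \<in> {0..T}" and at: "at x within {0..T} = at x"
      by (auto intro: at_within_Icc_at)
    note v' = v[OF x', unfolded at] and w' = w[OF x', unfolded at]
    show "((\<lambda>x. phi p (u' x)) has_real_derivative y x) (at x)"
      unfolding phi_u' y_def
      by (rule derivative_eq_intros v' w' refl)+ (simp add: algebra_simps)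
    have "f (u x) = k (v x) * phi p (u x)"
      unfolding k_def u_def phi_e using \<sigma>2 by simp
    then show "- y x + q x * phi p (u x) = l * m x * f (u x)"
      unfolding y_def u_def phi_e by (simp add: algebra_simps)
  qed (use per in \<open>simp_all add: u_def u'_def\<close>)
  moreover have "0 < \<sigma> * u x" for x
    unfolding u_def mult.assoc[symmetric] \<sigma>2 by simp
  ultimately show thesis using that by blast
qed

theorem theorem5p4:
  fixes T p f_inf l :: real and q m f :: "real \<Rightarrow> real"
  assumes "T > 0" and "1 < p"
    and "continuous_on {0..T} q" and "\<forall>x\<in>{0..T}. q x \<ge> 0" and "\<exists>x\<in>{0..T}. q x \<noteq> 0"
    and "continuous_on {0..T} m" and "\<exists>x\<in>{0..T}. m x > 0" and "\<exists>x\<in>{0..T}. m x < 0"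
    and "continuous_on UNIV f" and "\<forall>s. s \<noteq> 0 \<longrightarrow> f s * s > 0"
    and "((\<lambda>s. f s / phi p s) \<longlongrightarrow> 0) (at 0)"
    and "((\<lambda>s. f s / phi p s) \<longlongrightarrow> f_inf) at_infinity" and "f_inf > 0"
    and "l \<in> {lambda0_plus T p q m / f_inf <..} \<union> {..< lambda0_minus T p q m / f_inf}"
  shows "\<exists>u_pos u_neg.
           periodic_solution T p q m f l u_pos \<and> periodic_solution T p q m f l u_neg \<and>
           (\<forall>x\<in>{0..T}. u_pos x > 0) \<and> (\<forall>x\<in>{0..T}. u_neg x < 0)"
proof -
  obtain U U' where W: "(U, U') \<in> W1p_per T p" and
    neg: "(LINT x:{0<..<T}|lebesgue. \<bar>U' x\<bar> powr p + (q x - l * m x * f_inf) * \<bar>U x\<bar> powr p) < 0"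
    by (rule negative_energy[OF assms(1-3,6-8,13,14)]) (rule that)
  note solution = signed_periodic_solution[OF assms(1-3) assms(4)[rule_format] assms(5,6,9,11,12) W neg]
  obtain u1 where u1: "periodic_solution T p q m f l u1" "\<And>x. x \<in> {0..T} \<Longrightarrow> 0 < 1 * u1 x"
    by (rule solution[of 1]) (simp, simp, rule that)
  obtain u2 where u2: "periodic_solution T p q m f l u2" "\<And>x. x \<in> {0..T} \<Longrightarrow> 0 < - 1 * u2 x"
    by (rule solution[of "- 1"]) (simp, simp, rule that)
  show ?thesis
    by (rule exI[of _ u1], rule exI[of _ u2]) (use u1 u2 in auto)
qed

end
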